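(* For every string $\Xi$ in the following sets, the graph $G(\Xi)$ is a long-refinement graph, i.e.\ $\mathrm{WL}_1(G(\Xi)) = |G(\Xi)|-1$: (1) $\{\mathrm{S011XX}\}$; (2) $\{\mathrm{S}1^k001^k\mathrm{X}1\mathrm{X}1^k0 \mid k \in \mathbb{N}_0\}$; (3) $\{\mathrm{S}1^k11001^k\mathrm{XX}1^k0 \mid k \in \mathbb{N}_0\}$; (4) $\{\mathrm{S}1^k0011^k\mathrm{XX}1^k10 \mid k \in \mathbb{N}_0\}$; (5) $\{\mathrm{S}011(011)^k00(110)^k\mathrm{XX}(011)^k0 \mid k \in \mathbb{N}_0\}$; (6) $\{\mathrm{S}(011)^k00(110)^k1\mathrm{X}0\mathrm{X}1(011)^k0 \mid k \in \mathbb{N}_0\}$.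
   Context: All graphs are finite, simple, undirected, with monochromatic initial colouring. Colour Refinement computes $\chi^0_G$ constant and $\chi^i_G(v) = \big(\chi^{i-1}_G(v), \{\!\{\chi^{i-1}_G(w) \mid w \in N(v)\}\!\}\big)$; $\pi^i_G$ is the partition of $V(G)$ into colour classes of $\chi^i_G$, and $\mathrm{WL}_1(G)$ is the least $j \geq 0$ with $\pi^j_G = \pi^{j+1}_G$. A long-refinement graph is a graph $G$ with $\mathrm{WL}_1(G) = |G|-1$. For a word $w$, $(w)^k$ is the $k$-fold concatenation of $w$ and $1^k = (1)^k$. For $\ell \geq 3$ and a string $\Xi\colon [\ell] \to \{0,1,\mathrm{S},\mathrm{X}\}$ with $\Xi(1) = \mathrm{S}$, no other S, and exactly two positions $r < r'$ with $\Xi(r) = \Xi(r') = \mathrm{X}$, the graph $G(\Xi)$ has vertex set $\{v_{i,j} \mid i \in [\ell], j \in [2]\}$ and edge set consisting of: $\{v_{i,1},v_{i,2}\}$ for every $i \in [\ell]$ with $\Xi(i)=1$; $\{v_{i,j},v_{i+1,j}\}$ for $i \in [\ell-1]$, $j \in [2]$; $\{v_{r,j}, v_{1,1}\}$ for $j\in[2]$; $\{v_{r',j}, v_{1,2}\}$ for $j \in [2]$; and additionally the edge $\{v_{\ell,1}, v_{\ell,2}\}$ (in all strings listed, the last letter is $0$ or X). *)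

theory Defs
  imports "HOL-Library.Multiset"
begin

section \<open>Finite simple undirected graphs\<close>

record 'a graph =
  verts :: "'a set"
  edges :: "'a set set"

definition simple_graph :: "'a graph \<Rightarrow> bool" where
  "simple_graph G \<longleftrightarrow> finite (verts G) \<and> (\<forall>e \<in> edges G. e \<subseteq> verts G \<and> card e = 2)"

definition neighbours :: "'a graph \<Rightarrow> 'a \<Rightarrow> 'a set" where
  "neighbours G v = {w. {v, w} \<in> edges G}"


section \<open>Colour Refinement\<close>

text \<open>Colours are the formal iterated pairs produced by the refinement, with a single
  initial colour (the monochromatic colouring).\<close>

datatype colour = Initial | Refined colour "colour multiset"

fun chi :: "'a graph \<Rightarrow> nat \<Rightarrow> 'a \<Rightarrow> colour" where
  "chi G 0 v = Initial"
| "chi G (Suc i) v = Refined (chi G i v) {# chi G i w. w \<in># mset_set (neighbours G v) #}"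

definition colour_partition :: "'a graph \<Rightarrow> nat \<Rightarrow> 'a set set" where
  "colour_partition G i = {{w \<in> verts G. chi G i w = chi G i v} | v. v \<in> verts G}"

definition WL1 :: "'a graph \<Rightarrow> nat" where
  "WL1 G = (LEAST j. colour_partition G j = colour_partition G (Suc j))"

text \<open>The equation is stated over the integers, so that \<open>|G| - 1\<close> is not truncated for
  the empty graph.\<close>

definition long_refinement_graph :: "'a graph \<Rightarrow> bool" where
  "long_refinement_graph G \<longleftrightarrow>
     simple_graph G \<and> int (WL1 G) = int (card (verts G)) - 1"


section \<open>The graph of a string\<close>

datatype letter = L0 | L1 | LS | LX

text \<open>Strings are lists, but positions are counted from 1.\<close>

definition letter_at :: "letter list \<Rightarrow> nat \<Rightarrow> letter" where
  "letter_at \<Xi> i = \<Xi> ! (i - 1)"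

definition X_positions :: "letter list \<Rightarrow> nat set" where
  "X_positions \<Xi> = {i \<in> {1..length \<Xi>}. letter_at \<Xi> i = LX}"

definition admissible :: "letter list \<Rightarrow> bool" where
  "admissible \<Xi> \<longleftrightarrow>
     3 \<le> length \<Xi> \<and>
     (\<forall>i \<in> {1..length \<Xi>}. letter_at \<Xi> i = LS \<longleftrightarrow> i = 1) \<and>
     card (X_positions \<Xi>) = 2"

text \<open>The vertex \<open>v\<^sub>i\<^sub>,\<^sub>j\<close> is the pair \<open>(i, j)\<close>. For admissible strings, \<open>Min\<close> and \<open>Max\<close> select
  the two positions \<open>r < r'\<close> carrying the letter X.\<close>

definition string_graph :: "letter list \<Rightarrow> (nat \<times> nat) graph" where
  "string_graph \<Xi> =
    (let l = length \<Xi>;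
         r = Min (X_positions \<Xi>);
         r' = Max (X_positions \<Xi>)
     in \<lparr> verts = {1..l} \<times> {1..2},
          edges =
            {{(i, 1), (i, 2)} | i. i \<in> {1..l} \<and> letter_at \<Xi> i = L1} \<union>
            {{(i, j), (i + 1, j)} | i j. i \<in> {1..l - 1} \<and> j \<in> {1..2}} \<union>
            {{(r, j), (1, 1)} | j. j \<in> {1..2}} \<union>
            {{(r', j), (1, 2)} | j. j \<in> {1..2}} \<union>
            {{(l, 1), (l, 2)}} \<rparr>)"

definition word_power :: "letter list \<Rightarrow> nat \<Rightarrow> letter list" where
  "word_power w k = concat (replicate k w)"


section \<open>The families of strings\<close>

text \<open>An exponent binds only the letter or parenthesised word immediately before it.\<close>

definition family1 :: "letter list set" where
  "family1 = {[LS, L0, L1, L1, LX, LX]}"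

definition family2 :: "letter list set" where
  "family2 = {[LS] @ word_power [L1] k @ [L0, L0] @ word_power [L1] k @ [LX, L1, LX]
     @ word_power [L1] k @ [L0] | k. True}"

definition family3 :: "letter list set" where
  "family3 = {[LS] @ word_power [L1] k @ [L1, L1, L0, L0] @ word_power [L1] k @ [LX, LX]
     @ word_power [L1] k @ [L0] | k. True}"

definition family4 :: "letter list set" where
  "family4 = {[LS] @ word_power [L1] k @ [L0, L0, L1] @ word_power [L1] k @ [LX, LX]
     @ word_power [L1] k @ [L1, L0] | k. True}"

definition family5 :: "letter list set" where
  "family5 = {[LS, L0, L1, L1] @ word_power [L0, L1, L1] k @ [L0, L0]
     @ word_power [L1, L1, L0] k @ [LX, LX] @ word_power [L0, L1, L1] k @ [L0] | k. True}"

definition family6 :: "letter list set" where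
  "family6 = {[LS] @ word_power [L0, L1, L1] k @ [L0, L0] @ word_power [L1, L1, L0] k
     @ [L1, LX, L0, LX, L1] @ word_power [L0, L1, L1] k @ [L0] | k. True}"


section \<open>The listed strings satisfy the requirements on \<open>\<Xi>\<close>\<close>

lemma card_X_positions: "card (X_positions \<Xi>) = count (mset \<Xi>) LX"
proof -
  have "X_positions \<Xi> = Suc ` {i. i < length \<Xi> \<and> \<Xi> ! i = LX}"
    unfolding X_positions_def letter_at_def
    by (fastforce simp: image_iff Suc_le_eq gr0_conv_Suc)
  then have "card (X_positions \<Xi>) = card {i. i < length \<Xi> \<and> \<Xi> ! i = LX}"
    by (simp add: card_image)
  also have "\<dots> = length (filter (\<lambda>x. x = LX) \<Xi>)"
    by (simp add: length_filter_conv_card)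
  also have "\<dots> = count (mset \<Xi>) LX"
    by (induction \<Xi>) auto
  finally show ?thesis .
qed

lemma admissible_Cons:
  assumes "2 \<le> length w" "LS \<notin> set w" "count (mset w) LX = 2"
  shows "admissible (LS # w)"
proof -
  have "letter_at (LS # w) i = LS \<longleftrightarrow> i = 1" if "i \<in> {1..length (LS # w)}" for i
  proof (cases "i = 1")
    case False
    with that have "letter_at (LS # w) i \<in> set w"
      by (auto simp: letter_at_def nth_Cons' intro!: nth_mem)
    with assms(2) False show ?thesis by metis
  qed (simp add: letter_at_def)
  with assms show ?thesis by (auto simp: admissible_def card_X_positions)
qed

lemma set_word_power: "set (word_power w k) \<subseteq> set w"
  by (auto simp: word_power_def)

lemma word_power_letters [simp]:
  "LS \<notin> set w \<Longrightarrow> LS \<notin> set (word_power w k)"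
  "LX \<notin> set w \<Longrightarrow> count (mset (word_power w k)) LX = 0"
  using set_word_power[of w k] by (auto simp: count_eq_zero_iff)

lemma families_admissible:
  assumes "\<Xi> \<in> family1 \<union> family2 \<union> family3 \<union> family4 \<union> family5 \<union> family6"
  shows "admissible \<Xi>" and "last \<Xi> \<in> {L0, LX}"
  using assms
  by (auto simp: family1_def family2_def family3_def family4_def family5_def family6_def
      simp del: count_mset intro!: admissible_Cons)

end

theory Submission
  imports Defs
begin

text \<open>A graph on \<open>n\<close> vertices takes at most \<open>n - 1\<close> rounds, so it is enough to see that the
  partition after round \<open>n - 2 = 2l - 2\<close> is not stable. At first the columns \<open>j = 1, 2\<close> look alike, and
  Colour Refinement acts on the \<open>l\<close> pairs. The columns can only be told apart at the pair 1, one round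
  after the pairs \<open>r\<close> and \<open>r'\<close> get different colours, and from there the distinction
  travels one pair per round; hence if \<open>r\<close> and \<open>r'\<close> are still alike after \<open>l - 2\<close> rounds, then
  \<open>v\<^sub>l\<^sub>,\<^sub>1\<close> and \<open>v\<^sub>l\<^sub>,\<^sub>2\<close> are alike after \<open>2l - 2\<close> rounds.

  On the pairs, refinement first peels off the classes of constant distance to the pairs split off at
  the bottom (in the families with \<open>k\<close>, the strip is folded in three, so that a class contains at most
  three pairs), one class per round; then it sweeps along the path and separates the pairs
  \<open>q + 1, q + 2, \<dots>\<close> from the rest of their classes, one per round, and reaches \<open>r\<close> last. Conversely, if
  \<open>r\<close> and \<open>r'\<close> had the same stable colour, running the sweep backwards would identify the pair 1
  with another one of the same distance but with different neighbours.\<close>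

section \<open>Colour Refinement on arbitrary graphs\<close>

text \<open>The converse implication is automatic, since a refined colour stores its
  predecessor.\<close>

definition stable_at :: "'a graph \<Rightarrow> nat \<Rightarrow> bool" where
  "stable_at G t \<longleftrightarrow>
     (\<forall>u \<in> verts G. \<forall>v \<in> verts G. chi G t u = chi G t v \<longrightarrow> chi G (Suc t) u = chi G (Suc t) v)"

lemma chi_Suc_eqD: "chi G (Suc t) u = chi G (Suc t) v \<Longrightarrow> chi G t u = chi G t v"
  by simp

lemma colour_partition_image:
  "colour_partition G i = (\<lambda>v. {w \<in> verts G. chi G i w = chi G i v}) ` verts G"
  by (auto simp: colour_partition_def)

lemma stable_at_iff: "colour_partition G t = colour_partition G (Suc t) \<longleftrightarrow> stable_at G t"
proof
  assume eq: "colour_partition G t = colour_partition G (Suc t)"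
  show "stable_at G t"
    unfolding stable_at_def
  proof (intro ballI impI)
    fix u v assume uv: "u \<in> verts G" "v \<in> verts G" "chi G t u = chi G t v"
    define C where "C = {w \<in> verts G. chi G t w = chi G t u}"
    have "C \<in> colour_partition G t"
      unfolding colour_partition_image C_def using uv(1) by (rule imageI)
    then have "C \<in> colour_partition G (Suc t)"
      by (simp only: eq)
    then obtain x where x: "C = {w \<in> verts G. chi G (Suc t) w = chi G (Suc t) x}" "x \<in> verts G"
      unfolding colour_partition_image by (rule imageE)
    have "u \<in> C" "v \<in> C"
      using uv by (simp_all add: C_def)
    then show "chi G (Suc t) u = chi G (Suc t) v"
      unfolding x(1) mem_Collect_eq by (elim conjE) (simp only:)
  qed
next
  assume "stable_at G t"
  then have "chi G (Suc t) w = chi G (Suc t) v \<longleftrightarrow> chi G t w = chi G t v"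
    if "v \<in> verts G" "w \<in> verts G" for v w
    using that by (metis chi_Suc_eqD stable_at_def)
  then have "{w \<in> verts G. chi G t w = chi G t v} = {w \<in> verts G. chi G (Suc t) w = chi G (Suc t) v}"
    if "v \<in> verts G" for v
    using that by (simp only: cong: conj_cong)
  then show "colour_partition G t = colour_partition G (Suc t)"
    unfolding colour_partition_image by (rule image_cong[OF refl])
qed

lemma neighbours_subset_verts: "simple_graph G \<Longrightarrow> neighbours G v \<subseteq> verts G"
  unfolding simple_graph_def neighbours_def by blast

lemma finite_neighbours: "simple_graph G \<Longrightarrow> finite (neighbours G v)"
  by (rule finite_subset[OF neighbours_subset_verts]) (simp_all add: simple_graph_def)

text \<open>On the entries of \<open>M + M'\<close> the map \<open>g\<close> factors through
  \<open>f\<close>. This transfers agreement of neighbourhoods from a colouring to a coarser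
  one.\<close>

lemma image_mset_factors:
  assumes "\<And>x y. x \<in># M + M' \<Longrightarrow> y \<in># M + M' \<Longrightarrow> f x = f y \<Longrightarrow> g x = g y"
    and "image_mset f M = image_mset f M'"
  shows "image_mset g M = image_mset g M'"
proof -
  define P where "P c x \<longleftrightarrow> x \<in># M + M' \<and> f x = c" for c x
  define h where "h c = g (SOME x. P c x)" for c
  have h: "g x = h (f x)" if "x \<in># M + M'" for x
  proof -
    have "P (f x) x" using that by (simp add: P_def)
    then have "P (f x) (SOME y. P (f x) y)" by (rule someI)
    then have "g (SOME y. P (f x) y) = g x"
      using that by (intro assms(1)) (simp_all only: P_def)
    then show ?thesis by (simp only: h_def)
  qed
  have "image_mset g M = image_mset h (image_mset f M)"
    by (auto simp: multiset.map_comp h intro!: image_mset_cong)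
  also have "\<dots> = image_mset g M'"
    unfolding assms(2) by (auto simp: multiset.map_comp h intro!: image_mset_cong)
  finally show ?thesis .
qed

lemma stable_at_Suc:
  assumes "simple_graph G" "stable_at G t"
  shows "stable_at G (Suc t)"
  unfolding stable_at_def
proof (intro ballI impI)
  fix u v assume uv: "u \<in> verts G" "v \<in> verts G" "chi G (Suc t) u = chi G (Suc t) v"
  have "image_mset (chi G (Suc t)) (mset_set (neighbours G u)) =
      image_mset (chi G (Suc t)) (mset_set (neighbours G v))"
  proof (rule image_mset_factors)
    show "image_mset (chi G t) (mset_set (neighbours G u)) =
        image_mset (chi G t) (mset_set (neighbours G v))"
      using uv(3) by simp
  next
    fix x y
    assume "x \<in># mset_set (neighbours G u) + mset_set (neighbours G v)"
      "y \<in># mset_set (neighbours G u) + mset_set (neighbours G v)"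
    then have "x \<in> verts G" "y \<in> verts G"
      using neighbours_subset_verts[OF assms(1)] finite_neighbours[OF assms(1)] by auto
    then show "chi G t x = chi G t y \<Longrightarrow> chi G (Suc t) x = chi G (Suc t) y"
      using assms(2) unfolding stable_at_def by blast
  qed
  then show "chi G (Suc (Suc t)) u = chi G (Suc (Suc t)) v"
    using uv(3) by (simp only: chi.simps(2)[of G "Suc t"])
qed

lemma stable_at_mono:
  assumes "simple_graph G" "stable_at G s" "s \<le> t"
  shows "stable_at G t"
  using assms(3) by (induction t rule: dec_induct) (auto intro: assms stable_at_Suc)

lemma card_chi_Suc:
  assumes "finite (verts G)" "\<not> stable_at G t"
  shows "card (chi G t ` verts G) < card (chi G (Suc t) ` verts G)"
proof -
  \<comment> \<open>Forgetting the last round maps the new colours onto the old ones; injectivity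
    would mean stability. The value at \<open>Initial\<close> is a dummy.\<close>
  define fst_colour where
    "fst_colour c = (case c of Refined c' _ \<Rightarrow> c' | Initial \<Rightarrow> Initial)" for c
  have im: "chi G t ` verts G = fst_colour ` chi G (Suc t) ` verts G"
    by (simp add: image_image fst_colour_def)
  have "\<not> inj_on fst_colour (chi G (Suc t) ` verts G)"
  proof
    assume "inj_on fst_colour (chi G (Suc t) ` verts G)"
    moreover have "fst_colour (chi G (Suc t) u) = chi G t u" for u
      by (simp add: fst_colour_def)
    ultimately have "stable_at G t"
      unfolding stable_at_def by (metis image_eqI inj_onD)
    then show False using assms(2) by contradiction
  qed
  then show ?thesis
    using assms(1) unfolding im
    by (metis card_image_le eq_card_imp_inj_on finite_imageI le_neq_implies_less)
qed

text \<open>Each unstable round adds a colour to the single initial one, so \<open>n\<close>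
  unstable rounds would give more than \<open>n\<close> colours on \<open>n\<close>
  vertices.\<close>

lemma ex_stable_at:
  assumes "simple_graph G" "verts G \<noteq> {}"
  shows "\<exists>t < card (verts G). stable_at G t"
proof (rule ccontr)
  assume "\<not> ?thesis"
  then have unstable: "\<not> stable_at G t" if "t < card (verts G)" for t
    using that by blast
  have fin: "finite (verts G)" using assms(1) by (simp add: simple_graph_def)
  have "t < card (chi G t ` verts G)" if "t \<le> card (verts G)" for t
    using that
  proof (induction t)
    case 0
    then show ?case using fin assms(2) by (simp add: card_gt_0_iff)
  next
    case (Suc t)
    then show ?case using card_chi_Suc[OF fin unstable, of t] by simp
  qed
  from this[of "card (verts G)"] show False
    using card_image_le[OF fin, of "chi G (card (verts G))"] by simp
qed

lemma long_refinementI: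
  assumes "simple_graph G" "card (verts G) = Suc (Suc n)" "\<not> stable_at G n"
  shows "long_refinement_graph G"
proof -
  have "verts G \<noteq> {}" using assms(2) by auto
  then obtain t where t: "t \<le> Suc n" "stable_at G t"
    using ex_stable_at[OF assms(1)] assms(2) by (metis less_Suc_eq_le)
  have "WL1 G = Suc n"
    unfolding WL1_def stable_at_iff
  proof (rule Least_equality)
    show "Suc n \<le> s" if "stable_at G s" for s
      using stable_at_mono[OF assms(1) that, of n] assms(3) by force
    \<comment> \<open>The bound just shown also applies to \<open>t\<close>, so
      \<open>t = Suc n\<close>.\<close>
    then show "stable_at G (Suc n)"
      using t by force
  qed
  then show ?thesis
    using assms by (simp add: long_refinement_graph_def)
qed


section \<open>Refining the graph of a string\<close>

text \<open>\<open>2 < r\<close> keeps the edges between the pair 1 and the X pairs apart from the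
  path edges between the pairs 1 and 2.\<close>

locale string_shape =
  fixes \<Xi> :: "letter list" and l r r' :: nat
  assumes l_def: "l = length \<Xi>"
    and X_positions: "X_positions \<Xi> = {r, r'}"
    and letter_1: "letter_at \<Xi> 1 = LS"
    and r_gt: "2 < r" and r_less: "r < r'" and r'_le: "r' \<le> l"
begin

abbreviation G where "G \<equiv> string_graph \<Xi>"

text \<open>Identifying the columns turns the edge inside a pair into a loop; the pair
  \<open>l\<close> has this edge whatever its letter.\<close>

definition loop :: "nat \<Rightarrow> bool" where
  "loop i \<longleftrightarrow> letter_at \<Xi> i = L1 \<or> i = l"

text \<open>The neighbour positions of the pair \<open>i\<close>, as long as the pairs \<open>r\<close> and \<open>r'\<close> have
  the same colour: \<open>v\<^sub>1\<^sub>,\<^sub>1\<close> sees the pair \<open>r\<close> and \<open>v\<^sub>1\<^sub>,\<^sub>2\<close> sees the pair \<open>r'\<close>, so one of the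
  two represents both.\<close>

definition N :: "nat \<Rightarrow> nat multiset" where
  "N i = (if i = 1 then {#2, r, r#} else
     {#i - 1#} + (if i < l then {#i + 1#} else {#}) + (if loop i then {#i#} else {#}) +
     (if i = r \<or> i = r' then {#1#} else {#}))"

text \<open>\<open>3 - j\<close> is the other column. Both columns of the pair \<open>r\<close> see
  the same vertex of the pair 1, and so do both columns of \<open>r'\<close>.\<close>

definition VN :: "nat \<Rightarrow> nat \<Rightarrow> (nat \<times> nat) multiset" where
  "VN i j = (if i = 1 then {#(2, j)#} + (if j = 1 then {#(r, 1), (r, 2)#} else {#(r', 1), (r', 2)#})
     else {#(i - 1, j)#} + (if i < l then {#(i + 1, j)#} else {#}) +
     (if loop i then {#(i, 3 - j)#} else {#}) +
     (if i = r then {#(1, 1)#} else {#}) + (if i = r' then {#(1, 2)#} else {#}))"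

lemma verts_G: "verts G = {1..l} \<times> {1..2}"
  by (simp add: string_graph_def Let_def l_def)

lemma edges_G: "edges G =
    {{(i, 1), (i, 2)} | i. i \<in> {1..l} \<and> letter_at \<Xi> i = L1} \<union>
    {{(i, j), (i + 1, j)} | i j. i \<in> {1..l - 1} \<and> j \<in> {1..2}} \<union>
    {{(r, j), (1, 1)} | j. j \<in> {1..2}} \<union>
    {{(r', j), (1, 2)} | j. j \<in> {1..2}} \<union>
    {{(l, 1), (l, 2)}}"
proof -
  have "Min {r, r'} = r" "Max {r, r'} = r'"
    using r_less by auto
  then show ?thesis
    by (simp only: string_graph_def Let_def X_positions l_def graph.simps)
qed

lemma simple_G: "simple_graph G"
  unfolding simple_graph_def verts_G edges_G
  using r_gt r_less r'_le by (auto simp: card_insert_if)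

lemma neighbours_G:
  assumes "i \<in> {1..l}" "j \<in> {1..2}"
  shows "neighbours G (i, j) = set_mset (VN i j)"
proof -
  have j: "j = 1 \<or> j = 2" using assms(2) by auto
  have l: "1 < l" using r_gt r_less r'_le by simp
  define loops :: "(nat \<times> nat) set set" where "loops = {{(i, 1), (i, 2)} | i. i \<in> {1..l} \<and> letter_at \<Xi> i = L1} \<union> {{(l, 1), (l, 2)}}"
  define paths :: "(nat \<times> nat) set set" where "paths = {{(i, j), (i + 1, j)} | i j. i \<in> {1..l - 1} \<and> j \<in> {1..2}}"
  define Xs :: "(nat \<times> nat) set set" where "Xs = {{(r, j), (1, 1)} | j. j \<in> {1..2}}"
  define Xs' :: "(nat \<times> nat) set set" where "Xs' = {{(r', j), (1, 2)} | j. j \<in> {1..2}}"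
  have G_Un: "edges G = loops \<union> paths \<union> Xs \<union> Xs'"
    unfolding edges_G loops_def paths_def Xs_def Xs'_def by (simp only: Un_ac)
  have e1: "{(i, j), (a, b)} \<in> loops
      \<longleftrightarrow> a = i \<and> b = 3 - j \<and> loop i" for a b
    using j assms(1) unfolding loop_def loops_def by (auto simp: doubleton_eq_iff)
  have e2: "{(i, j), (a, b)} \<in> paths
      \<longleftrightarrow> b = j \<and> (a = i + 1 \<and> i < l \<or> a = i - 1 \<and> 1 < i)"
    (is "?L \<longleftrightarrow> ?R") for a b
  proof
    show ?R if ?L using that by (auto simp: paths_def doubleton_eq_iff)
  next
    assume ?R
    then consider "b = j" "a = i + 1" "i < l" | "b = j" "a = i - 1" "1 < i" by blast
    then show ?L
    proof cases
      case 1
      then have "{(i, j), (a, b)} = {(i, j), (i + 1, j)} \<and> i \<in> {1..l - 1} \<and> j \<in> {1..2}"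
        using assms by auto
      then show ?thesis unfolding paths_def by blast
    next
      case 2
      then have "{(i, j), (a, b)} = {(i - 1, j), (i - 1 + 1, j)} \<and> i - 1 \<in> {1..l - 1} \<and> j \<in> {1..2}"
        using assms by auto
      then show ?thesis unfolding paths_def by blast
    qed
  qed
  have two: "{f j | j. j \<in> {1..2::nat}} = {f 1, f 2}" for f :: "nat \<Rightarrow> (nat \<times> nat) set"
    by (auto simp: atLeastAtMost_iff le_Suc_eq numeral_2_eq_2)
  have e3: "{(i, j), (a, b)} \<in> Xs
      \<longleftrightarrow> i = r \<and> a = 1 \<and> b = 1 \<or> i = 1 \<and> j = 1 \<and> a = r \<and> b \<in> {1, 2}" for a b
    using j r_gt unfolding Xs_def two by (auto simp: doubleton_eq_iff)
  have e4: "{(i, j), (a, b)} \<in> Xs'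
      \<longleftrightarrow> i = r' \<and> a = 1 \<and> b = 2 \<or> i = 1 \<and> j = 2 \<and> a = r' \<and> b \<in> {1, 2}" for a b
    using j r_gt r_less unfolding Xs'_def two by (auto simp: doubleton_eq_iff)
  have "(a, b) \<in> neighbours G (i, j) \<longleftrightarrow>
      (a = i \<and> b = 3 - j \<and> loop i) \<or>
      (b = j \<and> (a = i + 1 \<and> i < l \<or> a = i - 1 \<and> 1 < i)) \<or>
      (i = r \<and> a = 1 \<and> b = 1 \<or> i = 1 \<and> j = 1 \<and> a = r \<and> b \<in> {1, 2}) \<or>
      (i = r' \<and> a = 1 \<and> b = 2 \<or> i = 1 \<and> j = 2 \<and> a = r' \<and> b \<in> {1, 2})" for a b
    unfolding neighbours_def G_Un mem_Collect_eq Un_iff e1 e2 e3 e4 by (simp only: disj_assoc)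
  moreover have "(a, b) \<in># VN i j \<longleftrightarrow>
      (a = i \<and> b = 3 - j \<and> loop i) \<or>
      (b = j \<and> (a = i + 1 \<and> i < l \<or> a = i - 1 \<and> 1 < i)) \<or>
      (i = r \<and> a = 1 \<and> b = 1 \<or> i = 1 \<and> j = 1 \<and> a = r \<and> b \<in> {1, 2}) \<or>
      (i = r' \<and> a = 1 \<and> b = 2 \<or> i = 1 \<and> j = 2 \<and> a = r' \<and> b \<in> {1, 2})" for a b
  proof (cases "i = 1")
    case True
    then have "\<not> loop i" using letter_1 l by (simp add: loop_def)
    then show ?thesis using True j r_gt r_less l by (elim disjE) (auto simp: VN_def)
  next
    case False
    have mem: "x \<in># (if c then {#y#} else {#}) \<longleftrightarrow> c \<and> x = y" for c and x y :: "nat \<times> nat"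
      by simp
    have "r \<noteq> 1" "r' \<noteq> 1" "1 < i" using False assms(1) r_gt r_less by auto
    then show ?thesis
      unfolding VN_def if_not_P[OF False] union_iff mem by auto
  qed
  ultimately have "(a, b) \<in> neighbours G (i, j) \<longleftrightarrow> (a, b) \<in># VN i j" for a b
    by (simp only:)
  then show ?thesis
    by (intro set_eqI) (simp only: split_paired_all)
qed

lemma mset_neighbours_G:
  assumes "i \<in> {1..l}" "j \<in> {1..2}"
  shows "mset_set (neighbours G (i, j)) = VN i j"
proof -
  have "count (VN i j) w \<le> 1" for w
  proof (cases "i = 1")
    case True
    then show ?thesis using r_gt r_less by (auto simp: VN_def)
  next
    case False
    have count_if: "count (if c then {#y#} else {#}) x = of_bool (c \<and> x = y)" for c and x y :: "nat \<times> nat"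
      by simp
    have "3 - j \<noteq> j" using assms(2) by presburger
    have "r \<noteq> r'" "2 < r" "2 < r'" "1 < i" using False assms(1) r_gt r_less by auto
    obtain a b where w: "w = (a, b)" by (cases w)
    \<comment> \<open>The five possible entries exclude each other: path and loop entries lie in
      three different pairs, the pair 1 is a fourth by \<open>2 < r\<close>, and \<open>r\<close>,
      \<open>r'\<close> are distinct.\<close>
    have at_most_one: "of_bool A + of_bool B + of_bool C + of_bool D + of_bool E \<le> (1 :: nat)"
      if "\<not> (A \<and> B)" "\<not> (A \<and> C)" "\<not> (A \<and> D)" "\<not> (A \<and> E)" "\<not> (B \<and> C)"
        "\<not> (B \<and> D)" "\<not> (B \<and> E)" "\<not> (C \<and> D)" "\<not> (C \<and> E)" "\<not> (D \<and> E)" for A B C D E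
      using that by (cases A; cases B; cases C; cases D; cases E) simp_all
    have count_single: "count {#(i - 1, j)#} w = of_bool (w = (i - 1, j))"
      by simp
    then show ?thesis
      using \<open>r \<noteq> r'\<close> \<open>2 < r\<close> \<open>2 < r'\<close> \<open>1 < i\<close> \<open>3 - j \<noteq> j\<close>
      unfolding VN_def if_not_P[OF False] count_union count_if count_single
      by - (rule at_most_one; auto simp: w)
  qed
  then have "mset_set (set_mset (VN i j)) = VN i j"
  proof (intro multiset_eqI)
    show "count (mset_set (set_mset (VN i j))) w = count (VN i j) w" for w
      using \<open>count (VN i j) w \<le> 1\<close>
      by (cases "w \<in># VN i j") (simp_all add: not_in_iff le_antisym Suc_le_eq)
  qed
  then show ?thesis unfolding neighbours_G[OF assms] .
qed


lemma chi_Suc_G: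
  assumes "i \<in> {1..l}" "j \<in> {1..2}"
  shows "chi G (Suc t) (i, j) = Refined (chi G t (i, j)) (image_mset (chi G t) (VN i j))"
  using mset_neighbours_G[OF assms] by simp

declare chi.simps(2) [simp del]

section \<open>Passing from vertices to pairs\<close>

lemma N_subset:
  assumes "i \<in> {1..l}" "x \<in># N i"
  shows "x \<in> {1..l}"
  using assms r_gt r_less r'_le by (auto simp: N_def split: if_splits)

lemma VN_subset:
  assumes "i \<in> {1..l}" "j \<in> {1..2}" "w \<in># VN i j"
  shows "fst w \<in> {1..l}" "snd w \<in> {1..2}"
  using assms r_gt r_less r'_le by (auto simp: VN_def split: if_splits)

text \<open>If columns are ignored, only the pair of a neighbour matters; \<open>F r = F r'\<close>
  allows the neighbours in \<open>r'\<close> of the second vertex of the pair 1 to be counted in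
  \<open>r\<close>.\<close>

lemma image_VN:
  assumes "\<And>i j. i \<in> {1..l} \<Longrightarrow> j \<in> {1..2} \<Longrightarrow> f (i, j) = F i" "F r = F r'"
    and "i \<in> {1..l}" "j \<in> {1..2}"
  shows "image_mset f (VN i j) = image_mset F (N i)"
proof -
  have "image_mset f (VN i j) = image_mset (F \<circ> fst) (VN i j)"
    using assms(1) VN_subset[OF assms(3,4)] by (intro image_mset_cong) (metis comp_apply prod.collapse)
  also have "\<dots> = image_mset F (image_mset fst (VN i j))"
    by (simp add: multiset.map_comp)
  also have "\<dots> = image_mset F (N i)"
    using assms(2) r_gt r_less by (auto simp: VN_def N_def)
  finally show ?thesis .
qed

text \<open>An upper bound on what \<open>t\<close> rounds can distinguish; the case
  \<open>i = i'\<close> says that the columns are still alike.\<close>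

definition determines :: "nat \<Rightarrow> (nat \<Rightarrow> 'c) \<Rightarrow> bool" where
  "determines t c \<longleftrightarrow> (\<forall>i \<in> {1..l}. \<forall>i' \<in> {1..l}. c i = c i' \<longrightarrow>
     (\<forall>j \<in> {1..2}. \<forall>j' \<in> {1..2}. chi G t (i, j) = chi G t (i', j')))"

lemma determinesD:
  assumes "determines t c" "i \<in> {1..l}" "i' \<in> {1..l}" "c i = c i'" "j \<in> {1..2}" "j' \<in> {1..2}"
  shows "chi G t (i, j) = chi G t (i', j')"
  using assms unfolding determines_def by blast

lemma r_mem: "r \<in> {1..l}" "r' \<in> {1..l}" "1 \<in> {1..l}"
  using r_gt r_less r'_le by auto

text \<open>While the bound \<open>c\<close> does not separate \<open>r\<close> from
  \<open>r'\<close>, one round on \<open>G\<close> is controlled by one refinement step on the pairs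
  with neighbourhoods \<open>N\<close>.\<close>

lemma determines_Suc:
  assumes c: "determines t c" "c r = c r'"
    and step: "\<And>i i'. i \<in> {1..l} \<Longrightarrow> i' \<in> {1..l} \<Longrightarrow> c' i = c' i' \<Longrightarrow>
      c i = c i' \<and> image_mset c (N i) = image_mset c (N i')"
  shows "determines (Suc t) c'"
  unfolding determines_def
proof (intro ballI impI)
  fix i i' j j' :: nat
  assume i: "i \<in> {1..l}" "i' \<in> {1..l}" "c' i = c' i'" "j \<in> {1..2}" "j' \<in> {1..2}"
  define F where "F i = chi G t (i, 1)" for i
  have F: "chi G t (i, j) = F i" if "i \<in> {1..l}" "j \<in> {1..2}" for i j
    unfolding F_def by (rule determinesD[OF c(1)]) (use that in auto)
  have Fr: "F r = F r'"
    unfolding F_def by (rule determinesD[OF c(1)]) (use r_mem c(2) in auto)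
  have "image_mset F (N i) = image_mset F (N i')"
  proof (rule image_mset_factors)
    show "image_mset c (N i) = image_mset c (N i')"
      using step[OF i(1-3)] by blast
    fix x y assume "x \<in># N i + N i'" "y \<in># N i + N i'" "c x = c y"
    then show "F x = F y"
      unfolding F_def using N_subset[OF i(1)] N_subset[OF i(2)]
      by (intro determinesD[OF c(1)]) auto
  qed
  then show "chi G (Suc t) (i, j) = chi G (Suc t) (i', j')"
    using step[OF i(1-3)] determinesD[OF c(1) i(1,2) _ i(4,5)]
    by (simp only: chi_Suc_G[OF i(1,4)] chi_Suc_G[OF i(2,5)] image_VN[OF F Fr i(1,4)]
        image_VN[OF F Fr i(2,5)])
qed

lemma determines_0: "determines 0 c"
  by (simp add: determines_def)

text \<open>Columns can first differ at the pair 1, and a difference at the pair \<open>i\<close>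
  has to arrive through \<open>i - 1\<close>. An X edge never creates one, as it leads from both
  columns to the same vertex.\<close>

lemma chi_columns_eq:
  assumes "determines t c" "c r = c r'" "s \<le> i" "i \<in> {1..l}"
  shows "chi G (t + s) (i, 1) = chi G (t + s) (i, 2)"
  using assms(3,4)
proof (induction s arbitrary: i)
  case 0
  then show ?case using determinesD[OF assms(1), of i i 1 2] by simp
next
  case (Suc s)
  show ?case
  proof (cases "i = 1")
    case True
    then have [simp]: "s = 0" using Suc.prems by simp
    have "chi G t (2, 1) = chi G t (2, 2)" "chi G t (r, 1) = chi G t (r', 1)"
      "chi G t (r, 2) = chi G t (r', 2)" "chi G t (1, 1) = chi G t (1, 2)"
      using assms(2) r_mem r_gt r_less r'_le by (auto intro!: determinesD[OF assms(1)])
    then show ?thesis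
      using Suc.prems by (simp add: True chi_Suc_G VN_def)
  next
    case False
    have "i - 1 \<in> {1..l}" "s \<le> i - 1" using False Suc.prems by auto
    then have IH: "chi G (t + s) (i - 1, 1) = chi G (t + s) (i - 1, 2)"
      "chi G (t + s) (i, 1) = chi G (t + s) (i, 2)"
      "i < l \<Longrightarrow> chi G (t + s) (i + 1, 1) = chi G (t + s) (i + 1, 2)"
      using Suc.IH[of "i - 1"] Suc.IH[of i] Suc.IH[of "i + 1"] Suc.prems False by auto
    then have "image_mset (chi G (t + s)) (VN i 1) = image_mset (chi G (t + s)) (VN i 2)"
      using False by (simp add: VN_def)
    then show ?thesis
      using IH(2) Suc.prems by (simp add: chi_Suc_G)
  qed
qed

section \<open>Stable colourings, viewed on pairs\<close>

definition equitable :: "(nat \<Rightarrow> 'c) \<Rightarrow> bool" where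
  "equitable F \<longleftrightarrow> (\<forall>i \<in> {1..l}. \<forall>i' \<in> {1..l}. F i = F i' \<longrightarrow>
     image_mset F (N i) = image_mset F (N i'))"

text \<open>Under stability, equality of the columns spreads from the pair \<open>l\<close> down to
  the pair 1. There the two vertices compare \<open>r\<close> with \<open>r'\<close>.\<close>

lemma equitable_if_stable:
  assumes "stable_at G t" "chi G t (l, 1) = chi G t (l, 2)"
  shows "\<exists>F :: nat \<Rightarrow> colour. equitable F \<and> F r = F r'"
proof -
  let ?f = "chi G t"
  have img: "image_mset ?f (VN i j) = image_mset ?f (VN i' j')"
    if "i \<in> {1..l}" "j \<in> {1..2}" "i' \<in> {1..l}" "j' \<in> {1..2}" "?f (i, j) = ?f (i', j')" for i j i' j'
  proof -
    have "chi G (Suc t) (i, j) = chi G (Suc t) (i', j')"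
      using assms(1) that unfolding stable_at_def verts_G by blast
    then show ?thesis using that by (simp add: chi_Suc_G)
  qed
  have col: "?f (l - d, 1) = ?f (l - d, 2)" if "d < l" for d
    using that
  proof (induction d rule: less_induct)
    case (less d)
    show ?case
    proof (cases d)
      case 0
      then show ?thesis using assms(2) by simp
    next
      case (Suc e)
      define i where "i = l - e"
      have i: "1 < i" "i \<le> l" "l - d = i - 1" using Suc less.prems by (auto simp: i_def)
      have eq: "?f (i, 1) = ?f (i, 2)" using less.IH[of e] Suc less.prems by (simp add: i_def)
      have up: "?f (i + 1, 1) = ?f (i + 1, 2)" if "i < l"
      proof -
        have "e \<noteq> 0" "l - (e - 1) = i + 1" using that i by (auto simp: i_def)
        then show ?thesis using less.IH[of "e - 1"] Suc less.prems by simp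
      qed
      \<comment> \<open>All neighbours of the pair \<open>i\<close> outside \<open>i - 1\<close> are
        known to agree in both columns, so cancelling them leaves the pair
        \<open>i - 1\<close>.\<close>
      have "image_mset ?f (VN i 1) = image_mset ?f (VN i 2)"
        using img[of i 1 i 2] eq i by simp
      then show ?thesis
        using i eq up by (cases "i < l"; cases "loop i") (auto simp: VN_def)
    qed
  qed
  have col: "?f (i, 1) = ?f (i, 2)" if "i \<in> {1..l}" for i
    using col[of "l - i"] that by auto
  define F where "F i = ?f (i, 1)" for i
  have F: "?f (i, j) = F i" if "i \<in> {1..l}" "j \<in> {1..2}" for i j
  proof -
    have "j = 1 \<or> j = 2" using that by auto
    then show ?thesis using col[OF that(1)] by (auto simp: F_def)
  qed
  have "image_mset ?f (VN 1 1) = image_mset ?f (VN 1 2)"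
    using img[of 1 1 1 2] col[of 1] r_mem by simp
  then have "{#?f (2, 1), F r, F r#} = {#?f (2, 2), F r', F r'#}"
    using F r_mem by (simp add: VN_def add_mset_commute)
  moreover have "?f (2, 1) = ?f (2, 2)"
    using col r_gt r_less r'_le by simp
  ultimately have "{#F r, F r#} = {#F r', F r'#}"
    by simp
  then have "set_mset {#F r, F r#} = set_mset {#F r', F r'#}"
    by (rule arg_cong)
  then have Fr: "F r = F r'"
    by simp
  have "equitable F"
    unfolding equitable_def
  proof (intro ballI impI)
    fix i i' assume i: "i \<in> {1..l}" "i' \<in> {1..l}" "F i = F i'"
    have "image_mset ?f (VN i 1) = image_mset ?f (VN i' 1)"
      using i by (intro img) (simp_all add: F_def)
    then show "image_mset F (N i) = image_mset F (N i')"
      using image_VN[OF F Fr i(1), of 1] image_VN[OF F Fr i(2), of 1] by simp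
  qed
  with Fr show ?thesis by blast
qed

text \<open>With \<open>2 * l\<close> vertices the critical round is \<open>l - 2 + l\<close>. The
  columns of the pair \<open>l\<close> are then still alike, so stability would yield an equitable
  colouring with equal values at \<open>r\<close> and \<open>r'\<close>.\<close>

lemma long_refinementI_columns:
  assumes "determines (l - 2) c" "c r = c r'"
    and "\<And>F :: nat \<Rightarrow> colour. equitable F \<Longrightarrow> F r \<noteq> F r'"
  shows "long_refinement_graph G"
proof (rule long_refinementI[OF simple_G])
  show "card (verts G) = Suc (Suc (l - 2 + l))"
    using r_gt r_less r'_le by (simp add: verts_G card_cartesian_product)
  show "\<not> stable_at G (l - 2 + l)"
  proof
    assume "stable_at G (l - 2 + l)"
    from equitable_if_stable[OF this chi_columns_eq[OF assms(1,2)]] show False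
      using assms(3) r_mem by auto
  qed
qed

end

section \<open>Layered strings\<close>

definition peel :: "(nat \<Rightarrow> bool) \<Rightarrow> nat \<Rightarrow> nat \<Rightarrow> nat + bool" where
  "peel coarse k d = (if d < k then Inl d else Inr (coarse d))"

text \<open>\<open>lev\<close> is the distance to the bottom layer. The neighbours of a pair other than 1 have the levels
  \<open>K d\<close>, where \<open>d\<close> is the level of the pair, and the pair has degree 2 iff \<open>thin d\<close>. If degree 2 is not
  confined to the bottom layer (families 5 and 6), peeling starts one round later (\<open>delay = 1\<close>) and
  the layers not yet peeled off are only distinguished by their degree (\<open>coarse\<close>).
  After \<open>delay + T\<close> rounds all layers are separate, one more round isolates the pairs \<open>1, \<dots>, q\<close>, and
  the equation for \<open>q + l\<close> says that the sweep then reaches \<open>r\<close> exactly in round \<open>l - 1\<close>.\<close>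

locale layered_shape = string_shape +
  fixes lev :: "nat \<Rightarrow> nat" and K :: "nat \<Rightarrow> nat multiset"
    and thin coarse :: "nat \<Rightarrow> bool" and q T delay :: nat
  assumes delay: "delay = 0 \<and> (\<forall>d. thin d \<longleftrightarrow> d = 0) \<and> (\<forall>d. \<not> coarse d) \<or> delay = 1 \<and> coarse = thin"
    and lev_N: "\<And>i. i \<in> {2..l} \<Longrightarrow> image_mset lev (N i) = K (lev i)"
    and lev_le: "\<And>i. i \<in> {1..l} \<Longrightarrow> lev i \<le> Suc T"
    and lev_r': "lev r' = lev r"
    and q: "1 \<le> q" "Suc q < r" "q + l = r + 2 + delay + T" "1 \<le> T"
    and lev_q: "lev q = lev 1" "\<And>i. i \<in> {1..l} \<Longrightarrow> lev i = lev q \<Longrightarrow> i = 1 \<or> i = q \<or> q = 1"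
    and thick_1: "\<not> thin (lev 1)"
    and K_1: "image_mset (peel coarse (T - 1)) {#lev 2, lev r, lev r#} =
        image_mset (peel coarse (T - 1)) (K (lev 1))"
    and K_1_neq: "{#lev 2, lev r, lev r#} \<noteq> K (lev 1)"
    and lev_1: "lev 1 \<le> Suc (lev 2)" "lev 1 \<le> Suc (lev r)"
        "lev 1 = Suc (lev 2) \<or> lev 1 = Suc (lev r)"
    and size_K: "\<And>d. d \<le> Suc T \<Longrightarrow> size (K d) = (if thin d then 2 else 3)"
    and K_ge: "\<And>d x. d \<le> Suc T \<Longrightarrow> x \<in># K d \<Longrightarrow> d \<le> Suc x"
    and K_pred: "\<And>d. d \<le> T \<Longrightarrow> d \<in># K (Suc d)"
    and K_coarse: "\<And>d e. d \<le> T \<Longrightarrow> e \<le> T \<Longrightarrow> coarse (Suc d) = coarse (Suc e) \<Longrightarrow>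
        image_mset coarse (K (Suc d)) = image_mset coarse (K (Suc e))"
    and K_bottom: "\<And>d. delay = 1 \<Longrightarrow> d \<le> Suc T \<Longrightarrow>
        (thin d \<and> (\<exists>x \<in># K d. thin x)) \<longleftrightarrow> d = 0"
    and lev_eq_r: "\<And>i. i \<in> {q + 2..l} \<Longrightarrow> lev i = lev r \<Longrightarrow> i = r \<or> i = r'"
    and lev_neq_1: "\<And>p. q < p \<Longrightarrow> Suc p < r \<Longrightarrow> lev p \<noteq> lev 1"
    and lev_2_neq: "q = 1 \<Longrightarrow> lev 2 \<noteq> lev r"
begin

lemma lev_N_1: "image_mset lev (N 1) = {#lev 2, lev r, lev r#}"
  by (simp add: N_def)

lemma pred_mem_N: "1 \<le> p \<Longrightarrow> p \<in># N (Suc p)"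
  by (simp add: N_def)

lemma size_N:
  assumes "i \<in> {1..l}"
  shows "size (N i) = (if thin (lev i) then 2 else 3)"
proof (cases "i = 1")
  case True
  then show ?thesis using thick_1 by (simp add: N_def)
next
  case False
  then have "size (image_mset lev (N i)) = (if thin (lev i) then 2 else 3)"
    using assms lev_N[of i] size_K[OF lev_le[OF assms]] by simp
  then show ?thesis by simp
qed

text \<open>Together with \<open>ex_lev_pred\<close> this makes \<open>lev\<close> the distance to
  the bottom layer.\<close>

lemma lev_neighbour:
  assumes "i \<in> {1..l}" "x \<in># N i"
  shows "lev i \<le> Suc (lev x)"
proof (cases "i = 1")
  case True
  then show ?thesis using assms lev_1 by (auto simp: N_def)
next
  case False
  have "lev x \<in># image_mset lev (N i)" using assms(2) by simp
  also have "image_mset lev (N i) = K (lev i)"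
    using False assms by (intro lev_N) auto
  finally show ?thesis using K_ge[OF lev_le[OF assms(1)]] by blast
qed

lemma ex_lev_pred:
  assumes "i \<in> {1..l}" "lev i = Suc d"
  shows "\<exists>x \<in># N i. lev x = d"
proof (cases "i = 1")
  case True
  then show ?thesis using assms lev_1(3) by (auto simp: N_def)
next
  case False
  have "d \<in># K (lev i)"
    using K_pred[of d] lev_le[OF assms(1)] assms(2) by simp
  also have "K (lev i) = image_mset lev (N i)"
    using False assms by (intro lev_N[symmetric]) auto
  finally show ?thesis by auto
qed

text \<open>The pair 1 violates \<open>K\<close>, but only in levels that
  \<open>peel coarse (T - 1)\<close> cannot tell apart.\<close>

lemma image_lev_N:
  assumes "i \<in> {1..l}"
  shows "image_mset (peel coarse (T - 1)) (image_mset lev (N i)) =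
      image_mset (peel coarse (T - 1)) (K (lev i))"
proof (cases "i = 1")
  case True
  then show ?thesis using K_1 by (simp only: lev_N_1)
next
  case False
  then show ?thesis using assms by (simp add: lev_N)
qed

lemma image_peel_N:
  assumes "i \<in> {1..l}" "k < T"
  shows "image_mset (peel coarse k) (image_mset lev (N i)) =
      image_mset (peel coarse k) (K (lev i))"
  by (rule image_mset_factors[OF _ image_lev_N[OF assms(1)]])
    (use assms(2) in \<open>auto simp: peel_def split: if_splits\<close>)

text \<open>Layers above \<open>k\<close> only have neighbours on levels at least \<open>k\<close>,
  visible merely through \<open>coarse\<close>, and \<open>K_coarse\<close> makes these views agree.
  So a round splits off no more than layer \<open>k\<close>.\<close>

lemma determines_peel: "k \<le> T \<Longrightarrow> determines (delay + k) (\<lambda>i. peel coarse k (lev i))"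
proof (induction k)
  case 0
  show ?case
  proof (cases "delay = 0")
    case True
    then show ?thesis by (simp add: determines_0)
  next
    case False
    have "determines (Suc 0) (\<lambda>i. peel coarse 0 (lev i))"
    \<comment> \<open>From the constant colouring, the first round reads off only degrees.\<close>
    proof (rule determines_Suc[OF determines_0[of "\<lambda>_. ()"]])
      fix i i' assume i: "i \<in> {1..l}" "i' \<in> {1..l}"
        and "peel coarse 0 (lev i) = peel coarse 0 (lev i')"
      then have "thin (lev i) = thin (lev i')"
        using False delay by (auto simp: peel_def)
      then have "size (N i) = size (N i')"
        using i by (simp add: size_N)
      then show "() = () \<and> image_mset (\<lambda>_. ()) (N i) = image_mset (\<lambda>_. ()) (N i')"
        by (simp add: image_mset_const_eq)
    qed simp
    then show ?thesis using False delay by auto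
  qed
next
  case (Suc k)
  have "determines (Suc (delay + k)) (\<lambda>i. peel coarse (Suc k) (lev i))"
  proof (rule determines_Suc)
    show "determines (delay + k) (\<lambda>i. peel coarse k (lev i))" using Suc by simp
    show "peel coarse k (lev r) = peel coarse k (lev r')" by (simp add: lev_r')
    fix i i' assume i: "i \<in> {1..l}" "i' \<in> {1..l}"
      and eq: "peel coarse (Suc k) (lev i) = peel coarse (Suc k) (lev i')"
    have "k < T" using Suc.prems by simp
    have "peel coarse k (lev i) = peel coarse k (lev i')"
      using eq by (auto simp: peel_def split: if_splits)
    moreover have "image_mset (peel coarse k) (image_mset lev (N i)) =
        image_mset (peel coarse k) (image_mset lev (N i'))"
    proof (cases "lev i = lev i'")
      case True
      then show ?thesis using i Suc.prems by (simp only: image_peel_N)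
    next
      case False
      then have *: "k < lev i" "k < lev i'" "coarse (lev i) = coarse (lev i')"
        using eq by (auto simp: peel_def split: if_splits)
      have "image_mset (peel coarse k) (image_mset lev (N i)) =
          image_mset Inr (image_mset coarse (K (lev i)))" if "i \<in> {1..l}" "k < lev i" for i
      proof -
        have "k \<le> x" if "x \<in># K (lev i)" for x
          using K_ge[OF lev_le that] that \<open>k < lev i\<close> \<open>i \<in> {1..l}\<close> by force
        then have "image_mset (peel coarse k) (K (lev i)) = image_mset (\<lambda>x. Inr (coarse x)) (K (lev i))"
          by (intro image_mset_cong) (simp add: peel_def leD)
        then show ?thesis
          unfolding image_peel_N[OF that(1) \<open>k < T\<close>] by (simp add: multiset.map_comp comp_def)
      qed
      moreover have "image_mset coarse (K (lev i)) = image_mset coarse (K (lev i'))"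
        using K_coarse[of "lev i - 1" "lev i' - 1"] * lev_le[OF i(1)] lev_le[OF i(2)] by simp
      ultimately show ?thesis using i * by simp
    qed
    ultimately show "peel coarse k (lev i) = peel coarse k (lev i') \<and>
        image_mset (\<lambda>i. peel coarse k (lev i)) (N i) = image_mset (\<lambda>i. peel coarse k (lev i)) (N i')"
      by (simp add: multiset.map_comp comp_def)
  qed
  then show ?case by simp
qed

section \<open>The sweep along the path\<close>

definition sweep :: "nat \<Rightarrow> nat \<Rightarrow> nat + nat" where
  "sweep p i = (if i \<le> p then Inl i else Inr (lev i))"

text \<open>A pair beyond \<open>p + 1\<close> has all its neighbours beyond \<open>p\<close>, where
  only levels are visible, except for the pair 1 at an X. Since X is itself visible from the level
  there, a round isolates at most \<open>p + 1\<close>.\<close>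

lemma determines_sweep: "q + s < r \<Longrightarrow> determines (delay + T + 1 + s) (sweep (q + s))"
proof (induction s)
  case 0
  \<comment> \<open>\<open>peel coarse T\<close> depends on levels only, and \<open>K\<close>
    describes the neighbour levels of every pair beyond \<open>q\<close>, as the pair 1 is not among
    them.\<close>
  have "determines (Suc (delay + T)) (sweep q)"
  proof (rule determines_Suc[OF determines_peel[OF order.refl]])
    show "peel coarse T (lev r) = peel coarse T (lev r')" by (simp add: lev_r')
    fix i i' assume i: "i \<in> {1..l}" "i' \<in> {1..l}" and eq: "sweep q i = sweep q i'"
    show "peel coarse T (lev i) = peel coarse T (lev i') \<and>
        image_mset (\<lambda>i. peel coarse T (lev i)) (N i) = image_mset (\<lambda>i. peel coarse T (lev i)) (N i')"
    proof (cases "i = i'")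
      case False
      then have *: "q < i" "q < i'" "lev i = lev i'"
        using eq by (auto simp: sweep_def split: if_splits)
      then have "image_mset lev (N i) = image_mset lev (N i')"
        using i q(1) by (simp add: lev_N)
      then have "image_mset (peel coarse T) (image_mset lev (N i)) =
          image_mset (peel coarse T) (image_mset lev (N i'))" by simp
      with * show ?thesis by (simp add: multiset.map_comp comp_def)
    qed simp
  qed
  then show ?case by simp
next
  case (Suc s)
  define p where "p = q + s"
  have "determines (Suc (delay + T + 1 + s)) (sweep (Suc p))"
  proof (rule determines_Suc)
    show "determines (delay + T + 1 + s) (sweep p)" using Suc by (simp add: p_def)
    show "sweep p r = sweep p r'" using Suc.prems r_less by (simp add: sweep_def lev_r' p_def)
    fix i i' assume i: "i \<in> {1..l}" "i' \<in> {1..l}" and eq: "sweep (Suc p) i = sweep (Suc p) i'"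
    show "sweep p i = sweep p i' \<and> image_mset (sweep p) (N i) = image_mset (sweep p) (N i')"
    proof (cases "i = i'")
      case False
      then have *: "Suc p < i" "Suc p < i'" "lev i = lev i'"
        using eq by (auto simp: sweep_def split: if_splits)
      have X: "i \<in> {r, r'} \<longleftrightarrow> i' \<in> {r, r'}"
        using lev_eq_r[of i] lev_eq_r[of i'] * i lev_r' by (auto simp: p_def)
      have split: "\<exists>M. N i = M + (if i \<in> {r, r'} then {#1#} else {#}) \<and> (\<forall>x \<in># M. p < x)"
        if "Suc p < i" for i
        using that by (auto simp: N_def)
      obtain M where M: "N i = M + (if i \<in> {r, r'} then {#1#} else {#})" "\<forall>x \<in># M. p < x"
        using split *(1) by blast
      obtain M' where M': "N i' = M' + (if i' \<in> {r, r'} then {#1#} else {#})" "\<forall>x \<in># M'. p < x"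
        using split *(2) by blast
      have "image_mset lev (N i) = image_mset lev (N i')"
        using * i q(1) by (simp add: lev_N)
      then have "image_mset lev M = image_mset lev M'"
        using X by (simp add: M(1) M'(1) split: if_splits)
      then have "image_mset Inr (image_mset lev M) = (image_mset Inr (image_mset lev M') :: (nat + nat) multiset)"
        by simp
      moreover have "image_mset (sweep p) M = image_mset Inr (image_mset lev M)" if "\<forall>x \<in># M. p < x" for M
        using that by (auto simp: multiset.map_comp sweep_def intro!: image_mset_cong)
      ultimately have "image_mset (sweep p) M = image_mset (sweep p) M'"
        using M(2) M'(2) by metis
      then have "image_mset (sweep p) (N i) = image_mset (sweep p) (N i')"
        using X by (simp add: M(1) M'(1))
      with * show ?thesis by (simp add: sweep_def)
    qed simp
  qed
  then show ?case by (simp add: p_def)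
qed

text \<open>Equal colours have equal degrees, which identifies the bottom layer; higher layers are
  then recognised by their distance to it.\<close>

lemma equitable_lev:
  fixes F :: "nat \<Rightarrow> colour"
  assumes "equitable F" "i \<in> {1..l}" "i' \<in> {1..l}" "F i = F i'"
  shows "lev i = lev i'"
proof -
  have nbr: "image_mset F (N i) = image_mset F (N i')"
    if "i \<in> {1..l}" "i' \<in> {1..l}" "F i = F i'" for i i'
    using assms(1) that unfolding equitable_def by blast
  have ex: "\<exists>y \<in># N i'. F y = F x"
    if "i \<in> {1..l}" "i' \<in> {1..l}" "F i = F i'" "x \<in># N i" for i i' x
  proof -
    have "F x \<in># image_mset F (N i')"
      using that(4) by (simp flip: nbr[OF that(1-3)])
    then show ?thesis by auto
  qed
  have thin: "thin (lev i) = thin (lev i')" if "i \<in> {1..l}" "i' \<in> {1..l}" "F i = F i'" for i i'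
    using arg_cong[OF nbr[OF that], of size] size_N[OF that(1)] size_N[OF that(2)]
    by (simp split: if_splits)
  have le: "lev i' \<le> lev i" if "i \<in> {1..l}" "i' \<in> {1..l}" "F i = F i'" for i i'
    using that
  proof (induction "lev i" arbitrary: i i')
    case 0
    show ?case
    proof (cases "delay = 0")
      case True
      then have "\<And>d. thin d \<longleftrightarrow> d = 0" using delay by auto
      then show ?thesis using thin[OF 0(2-4)] 0(1) by simp
    next
      case False
      then have 1: "delay = 1" using delay by auto
      \<comment> \<open>With \<open>delay = 1\<close> degree 2 also occurs higher up, and the bottom
        layer is recognised by a further neighbour of degree 2.\<close>
      have bottom: "lev i = 0 \<longleftrightarrow> thin (lev i) \<and> (\<exists>x \<in># N i. thin (lev x))" if "i \<in> {1..l}" for i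
      proof (cases "i = 1")
        case True
        have "thin 0" using K_bottom[OF 1, of 0] by simp
        then have "lev 1 \<noteq> 0" using thick_1 by metis
        then show ?thesis using thick_1 True by simp
      next
        case False
        have "(\<exists>x \<in># image_mset lev (N i). thin x) \<longleftrightarrow> (\<exists>x \<in># K (lev i). thin x)"
          using lev_N[of i] False that by auto
        then show ?thesis using K_bottom[OF 1 lev_le[OF that]] by auto
      qed
      obtain x where x: "thin (lev i)" "x \<in># N i" "thin (lev x)"
        using bottom[OF 0(2)] 0(1) by auto
      obtain y where y: "y \<in># N i'" "F y = F x"
        using ex[OF 0(2-4) x(2)] by blast
      have "thin (lev y)"
        using thin[of x y] x y N_subset[OF 0(2)] N_subset[OF 0(3)] by auto
      then have "lev i' = 0"
        using bottom[OF 0(3)] y(1) thin[OF 0(2-4)] x(1) by auto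
      then show ?thesis by simp
    qed
  next
    case (Suc d)
    obtain x where x: "x \<in># N i" "lev x = d"
      using ex_lev_pred[OF Suc(3)] Suc(2) by metis
    obtain y where y: "y \<in># N i'" "F y = F x"
      using ex[OF Suc(3-5) x(1)] by blast
    have "lev y \<le> lev x"
      using Suc(1)[of x y] x y N_subset[OF Suc(3)] N_subset[OF Suc(4)] by auto
    then show ?case
      using lev_neighbour[OF Suc(4) y(1)] x(2) Suc(2) by simp
  qed
  show ?thesis
    using le[OF assms(2-4)] le[OF assms(3,2) assms(4)[symmetric]] by simp
qed

text \<open>The sweep run backwards: if \<open>r\<close> and \<open>r'\<close> agree, each pair from
  \<open>r\<close> down to \<open>q + 1\<close> shares its colour with a later pair. Then the pair 1
  shares its colour with some \<open>y\<close> of the same level, contradicting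
  \<open>K_1_neq\<close>.\<close>

lemma equitable_separates:
  fixes F :: "nat \<Rightarrow> colour"
  assumes "equitable F"
  shows "F r \<noteq> F r'"
proof
  assume Fr: "F r = F r'"
  have nbr: "image_mset F (N i) = image_mset F (N i')"
    if "i \<in> {1..l}" "i' \<in> {1..l}" "F i = F i'" for i i'
    using assms that unfolding equitable_def by blast
  have N_cases: "x = 1 \<and> (i = r \<or> i = r') \<or> i - 1 \<le> x" if "x \<in># N i" "i \<noteq> 1" for i x
    using that by (auto simp: N_def split: if_splits)
  have chain: "\<exists>j \<in> {1..l}. r - d < j \<and> F (r - d) = F j" if "r - d > q" for d
    using that
  proof (induction d)
    case 0
    then show ?case using Fr r_mem r_less by force
  next
    case (Suc d)
    define p where "p = r - Suc d"
    have p: "Suc p = r - d" "q < p" "p < r" using Suc.prems by (auto simp: p_def)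
    have mem: "Suc p \<in> {1..l}" "p \<in> {1..l}" using p q(1) r_less r'_le by auto
    show ?case
    proof (cases "d = 0")
      case True
      then have r: "r = Suc p" using p by simp
      \<comment> \<open>\<open>lev_neq_1\<close> does not cover \<open>p = r - 1\<close>; instead
        the entry 1 common to \<open>N r\<close> and \<open>N r'\<close> is cancelled.\<close>
      have "\<exists>M. N r = add_mset 1 M \<and> p \<in># M"
        using r q p by (auto simp: N_def)
      then obtain M where M: "N r = add_mset 1 M" "p \<in># M" by blast
      have p_less: "p < r' - 1" "p < r'" "p < r' + 1" "r' \<noteq> 1" "r' \<noteq> r"
        using r r_less by auto
      have "\<exists>M. N r' = add_mset 1 M \<and> (\<forall>x \<in># M. p < x)"
        using p_less by (intro exI[of _ "N r' - {#1#}"]) (auto simp: N_def)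
      then obtain M' where M': "N r' = add_mset 1 M'" "\<forall>x \<in># M'. p < x" by blast
      have "image_mset F M = image_mset F M'"
        using nbr[OF r_mem(1,2) Fr] M(1) M'(1) by simp
      then have "F p \<in># image_mset F M'" using M(2) by (metis image_eqI set_image_mset)
      then obtain x where "x \<in># M'" "F x = F p" by auto
      then show ?thesis
        using M' N_subset[OF r_mem(2)] by (metis p_def union_single_eq_member insert_iff set_mset_add_mset_insert)
    next
      case False
      obtain j where j: "j \<in> {1..l}" "Suc p < j" "F (Suc p) = F j"
        using Suc.IH Suc.prems p by auto
      have "p \<in># N (Suc p)" using p q(1) by (intro pred_mem_N) simp
      then have "F p \<in># image_mset F (N j)"
        using nbr[OF mem(1) j(1,3)] by (metis image_eqI set_image_mset)
      then obtain x where x: "x \<in># N j" "F x = F p" by auto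
      have "lev x = lev p"
        using equitable_lev[OF assms N_subset[OF j(1) x(1)] mem(2) x(2)] .
      moreover have "lev p \<noteq> lev 1" using lev_neq_1[OF p(2)] p False by simp
      \<comment> \<open>The only neighbour of \<open>j\<close> that could lie below
        \<open>j - 1\<close> is the pair 1, which is excluded by its level.\<close>
      ultimately have "p < x" using N_cases[OF x(1)] j(2) by auto
      then show ?thesis using x N_subset[OF j(1) x(1)] by (auto simp: p_def)
    qed
  qed
  obtain j where j: "j \<in> {1..l}" "Suc q < j" "F (Suc q) = F j"
    using chain[of "r - Suc q"] q by auto
  have mem: "Suc q \<in> {1..l}" "q \<in> {1..l}" using q r_less r'_le by auto
  have "q \<in># N (Suc q)" using q(1) by (rule pred_mem_N)
  then have "F q \<in># image_mset F (N j)"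
    using nbr[OF mem(1) j(1,3)] by (metis image_eqI set_image_mset)
  then obtain x where x: "x \<in># N j" "F x = F q" by auto
  have xl: "x \<in> {1..l}" using N_subset[OF j(1) x(1)] .
  have lev_x: "lev x = lev q"
    using equitable_lev[OF assms xl mem(2) x(2)] .
  have "x \<noteq> q"
  proof
    assume "x = q"
    then have "q = 1" "j = r \<or> j = r'"
      using N_cases[OF x(1)] j(2) by auto
    then have "lev 2 = lev r"
      using equitable_lev[OF assms mem(1) j(1,3)] lev_r' by (auto simp: numeral_2_eq_2)
    then show False using lev_2_neq \<open>q = 1\<close> by simp
  qed
  \<comment> \<open>For \<open>q = 1\<close> the partner of the pair 1 is \<open>x\<close>.
    Otherwise the layer of \<open>q\<close> consists of 1 and \<open>q\<close>, so
    \<open>x = 1\<close> and the partner is \<open>q\<close>.\<close>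
  obtain y where y: "y \<in> {2..l}" "F 1 = F y" "lev y = lev 1"
  proof (cases "q = 1")
    case True
    then show ?thesis using that[of x] xl \<open>x \<noteq> q\<close> x lev_x lev_q by auto
  next
    case False
    then show ?thesis using that[of q] lev_q(2)[OF xl lev_x] \<open>x \<noteq> q\<close> x lev_q(1) mem q(1) by auto
  qed
  have "image_mset lev (N 1) = image_mset lev (N y)"
  proof (rule image_mset_factors)
    show "image_mset F (N 1) = image_mset F (N y)"
      using y r_mem by (intro nbr) auto
    fix u v assume uv: "u \<in># N 1 + N y" "v \<in># N 1 + N y" "F u = F v"
    have "y \<in> {1..l}" using y(1) by simp
    then have "u \<in> {1..l}" "v \<in> {1..l}"
      using uv(1,2) N_subset[OF r_mem(3)] N_subset by (metis union_iff)+
    then show "lev u = lev v"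
      by (rule equitable_lev[OF assms _ _ uv(3)])
  qed
  then show False
    using K_1_neq lev_N[OF y(1)] y(3) by (simp only: lev_N_1)
qed

lemma long_refinement_G: "long_refinement_graph G"
proof (rule long_refinementI_columns)
  \<comment> \<open>The sweep stops at \<open>r - 1\<close>, the last position that leaves
    \<open>r\<close> and \<open>r'\<close> together.\<close>
  have "delay + T + 1 + (r - 1 - q) = l - 2" "q + (r - 1 - q) = r - 1"
    using q by auto
  then show "determines (l - 2) (sweep (r - 1))"
    using determines_sweep[of "r - 1 - q"] q by simp
  show "sweep (r - 1) r = sweep (r - 1) r'"
    using r_gt r_less lev_r' by (simp add: sweep_def)
qed (rule equitable_separates)

end

section \<open>Letters of the words and levels of the folded strip\<close>

lemma length_word_power [simp]: "length (word_power w k) = k * length w"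
  by (induction k) (auto simp: word_power_def)

lemma nth_word_power:
  "n < k * length w \<Longrightarrow> word_power w k ! n = w ! (n mod length w)"
proof (induction k arbitrary: n)
  case (Suc k)
  have "word_power w (Suc k) = w @ word_power w k"
    by (simp add: word_power_def)
  then show ?case
    using Suc by (auto simp: nth_append le_mod_geq)
qed simp

lemma nth_word_power_letters:
  "n < k \<Longrightarrow> word_power [L1] k ! n = L1"
  "n < k * 3 \<Longrightarrow> word_power [L0, L1, L1] k ! n = (if n mod 3 = 0 then L0 else L1)"
  "n < k * 3 \<Longrightarrow> word_power [L1, L1, L0] k ! n = (if n mod 3 = 2 then L0 else L1)"
proof -
  have "n mod 3 = 0 \<or> n mod 3 = 1 \<or> n mod 3 = 2" by linarith
  then show "n < k * 3 \<Longrightarrow> word_power [L0, L1, L1] k ! n = (if n mod 3 = 0 then L0 else L1)"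
    "n < k * 3 \<Longrightarrow> word_power [L1, L1, L0] k ! n = (if n mod 3 = 2 then L0 else L1)"
    by (auto simp: nth_word_power)
qed (simp add: nth_word_power)

lemma string_shapeI:
  assumes "\<Xi> \<in> family1 \<union> family2 \<union> family3 \<union> family4 \<union> family5 \<union> family6"
    and "letter_at \<Xi> r = LX" "letter_at \<Xi> r' = LX" "2 < r" "r < r'" "r' \<le> length \<Xi>"
  shows "string_shape \<Xi> (length \<Xi>) r r'"
proof
  have "admissible \<Xi>" using families_admissible(1)[OF assms(1)] .
  then have adm: "card (X_positions \<Xi>) = 2" "letter_at \<Xi> 1 = LS"
    by (auto simp: admissible_def)
  have "{r, r'} \<subseteq> X_positions \<Xi>"
    using assms by (auto simp: X_positions_def)
  moreover have "card {r, r'} = 2" "finite (X_positions \<Xi>)"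
    using assms(5) by (auto simp: X_positions_def)
  ultimately show "X_positions \<Xi> = {r, r'}"
    using adm(1) by (metis card_subset_eq)
  show "letter_at \<Xi> 1 = LS" using adm(2) .
qed (use assms in auto)

text \<open>The strip is folded at \<open>m | m + 1\<close> (the letters 00) and at \<open>h | h + 1\<close>; levels are
  counted from the first fold and from the end \<open>l\<close> of the strip.\<close>

definition fold_lev :: "nat \<Rightarrow> nat \<Rightarrow> nat \<Rightarrow> nat \<Rightarrow> nat" where
  "fold_lev m h l i = (if i \<le> m then m - i else if i \<le> h then i - m - 1 else l - i)"

context string_shape
begin

lemma image_N:
  assumes "i \<noteq> 1"
  shows "image_mset f (N i) = {#f (i - 1)#} + (if i < l then {#f (i + 1)#} else {#}) +
     (if loop i then {#f i#} else {#}) + (if i = r \<or> i = r' then {#f 1#} else {#})"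
  using assms by (simp add: N_def)

text \<open>Away from the second fold the path neighbours lie one level up and one down. At level 0
  the lower one is replaced by level 0 itself, across the first fold or through the forced loop at
  \<open>l\<close>. The level \<open>a\<close> of the pair 1 may deviate from the folded one, hence
  the condition at \<open>i = 2\<close>.\<close>

lemma image_fold_lev_N:
  assumes lev: "lev = (fold_lev m h l)(1 := a)"
    and mh: "2 \<le> m" "m + 2 \<le> h" "h + 2 \<le> l" "letter_at \<Xi> l \<noteq> L1"
    and i: "i \<in> {2..l}" "i = 2 \<Longrightarrow> a = m - 1" "i \<noteq> h" "i \<noteq> h + 1"
  shows "image_mset lev (N i) =
      (if lev i = 0 then {#0, 1#} else {#lev i - 1, lev i + 1#}) +
      (if letter_at \<Xi> i = L1 then {#lev i#} else {#}) + (if i = r \<or> i = r' then {#a#} else {#})"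
proof -
  have "lev 1 = a" by (simp add: lev)
  have "i \<noteq> 1" using i by simp
  have lev_i: "lev i = fold_lev m h l i" using i by (simp add: lev)
  have "lev (i + 1) = fold_lev m h l (i + 1)" using i by (simp add: lev)
  have "lev (i - 1) = fold_lev m h l (i - 1)" using i mh by (auto simp: lev fold_lev_def)
  consider "i < m" | "i = m" | "i = m + 1" | "m + 1 < i" "i < h" | "h + 1 < i" "i < l" | "i = l"
    using i by fastforce
  \<comment> \<open>For \<open>i = l\<close> the forced loop stands in for the missing neighbour
    \<open>l + 1\<close>.\<close>
  then have "{#lev (i - 1)#} + (if i < l then {#lev (i + 1)#} else {#lev i#}) =
      (if lev i = 0 then {#0, 1#} else {#lev i - 1, lev i + 1#})"
  proof cases
    case 1
    then have "lev (i - 1) = lev i + 1" "lev (i + 1) = lev i - 1" "lev i \<noteq> 0" "i < l"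
      unfolding \<open>lev (i + 1) = _\<close> \<open>lev (i - 1) = _\<close> lev_i using mh i(1) by (auto simp: fold_lev_def)
    then show ?thesis by (simp add: add_mset_commute)
  next
    case 2
    then have "lev (i - 1) = 1" "lev (i + 1) = 0" "lev i = 0" "i < l"
      unfolding \<open>lev (i + 1) = _\<close> \<open>lev (i - 1) = _\<close> lev_i using mh i(1) by (auto simp: fold_lev_def)
    then show ?thesis by (simp add: add_mset_commute)
  next
    case 3
    then have "lev (i - 1) = 0" "lev (i + 1) = 1" "lev i = 0" "i < l"
      unfolding \<open>lev (i + 1) = _\<close> \<open>lev (i - 1) = _\<close> lev_i using mh i(1) by (auto simp: fold_lev_def)
    then show ?thesis by simp
  next
    case 4
    then have "lev (i - 1) = lev i - 1" "lev (i + 1) = lev i + 1" "lev i \<noteq> 0" "i < l"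
      unfolding \<open>lev (i + 1) = _\<close> \<open>lev (i - 1) = _\<close> lev_i using mh i(1) by (auto simp: fold_lev_def)
    then show ?thesis by simp
  next
    case 5
    then have "lev (i - 1) = lev i + 1" "lev (i + 1) = lev i - 1" "lev i \<noteq> 0" "i < l"
      unfolding \<open>lev (i + 1) = _\<close> \<open>lev (i - 1) = _\<close> lev_i using mh i(1) by (auto simp: fold_lev_def)
    then show ?thesis by (simp add: add_mset_commute)
  next
    case 6
    then have "lev (i - 1) = 1" "lev i = 0"
      unfolding \<open>lev (i - 1) = _\<close> lev_i using mh i(1) by (auto simp: fold_lev_def)
    then show ?thesis using 6 by (simp add: add_mset_commute)
  qed
  moreover have "(if i < l then {#lev (i + 1)#} else {#}) + (if loop i then {#lev i#} else {#}) =
      (if i < l then {#lev (i + 1)#} else {#lev i#}) + (if letter_at \<Xi> i = L1 then {#lev i#} else {#})"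
    using i(1) mh(4) by (auto simp: loop_def)
  moreover have "A + B + C + D = P + L + D" if "A + B' = P" "B + C = B' + L"
    for A B C D P L B' :: "nat multiset"
    using that by (metis add.assoc)
  ultimately show ?thesis
    unfolding image_N[OF \<open>i \<noteq> 1\<close>] \<open>lev 1 = a\<close> by blast
qed

text \<open>The levels \<open>h - m - 1\<close> and \<open>l - h - 1\<close> on the two sides of the
  second fold may be equal or differ by one in the families.\<close>

lemma image_fold_lev_N_h:
  assumes lev: "lev = (fold_lev m h l)(1 := a)"
    and mh: "2 \<le> m" "m + 2 \<le> h" "h + 2 \<le> l"
  shows "image_mset lev (N h) = {#h - m - 2, l - h - 1#} +
      (if letter_at \<Xi> h = L1 then {#h - m - 1#} else {#}) + (if h = r \<or> h = r' then {#a#} else {#})"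
    and "image_mset lev (N (h + 1)) = {#h - m - 1, l - h - 2#} +
      (if letter_at \<Xi> (h + 1) = L1 then {#l - h - 1#} else {#}) +
      (if h + 1 = r \<or> h + 1 = r' then {#a#} else {#})"
  using mh by (auto simp: image_N lev fold_lev_def loop_def diff_diff_eq)

end


section \<open>The six families\<close>

lemma long_refinement_family1:
  assumes "\<Xi> \<in> family1"
  shows "long_refinement_graph (string_graph \<Xi>)"
proof -
  have \<Xi>: "\<Xi> = [LS, L0, L1, L1, LX, LX]"
    using assms by (simp add: family1_def)
  have letters: "letter_at \<Xi> 2 = L0" "letter_at \<Xi> 3 = L1" "letter_at \<Xi> 4 = L1"
    "letter_at \<Xi> 5 = LX" "letter_at \<Xi> 6 = LX"
    by (simp_all add: \<Xi> letter_at_def)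
  have len: "length \<Xi> = 6" by (simp add: \<Xi>)
  interpret string_shape \<Xi> 6 5 6
    using string_shapeI[of \<Xi> 5 6] assms letters unfolding len by simp
  \<comment> \<open>Entry 0 is a dummy, as positions start at 1. The pair 2, the only one of degree
    2, is the bottom layer.\<close>
  define lev where "lev i = [0, 1, 0, 1, 2, 2, 2 :: nat] ! i" for i
  \<comment> \<open>Level 3, which is \<open>Suc T\<close>, contains no pair; the generic formula
    covers it.\<close>
  define K :: "nat \<Rightarrow> nat multiset" where "K d = (if d = 0 then {#1, 1#}
    else if d = 2 then {#1, 2, 2#} else {#d - 1, d, d + 1#})" for d
  have lev_simps: "lev 1 = 1" "lev 2 = 0" "lev 3 = 1" "lev 4 = 2" "lev 5 = 2" "lev 6 = 2" "lev (Suc 0) = 1"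
    by (simp_all add: lev_def)
  have upto_6: "i = 1 \<or> i = 2 \<or> i = 3 \<or> i = 4 \<or> i = 5 \<or> i = 6" if "i \<in> {1..6}" for i :: nat
    using that by auto
  interpret layered_shape \<Xi> 6 5 6 lev K "\<lambda>d. d = 0" "\<lambda>_. False" 3 2 0
  proof
    show "image_mset lev (N i) = K (lev i)" if "i \<in> {2..6}" for i
      using upto_6[of i] that
      by (auto simp: image_N loop_def letters K_def lev_simps)
    show "lev i \<le> Suc 2" "lev i = lev 3 \<Longrightarrow> i = 1 \<or> i = 3 \<or> 3 = (1 :: nat)" if "i \<in> {1..6}" for i
      using upto_6[OF that] by (auto simp: lev_simps)
    show "i = 5 \<or> i = 6" if "i \<in> {3 + 2..6}" for i :: nat
      using that by auto
    show "{#lev 2, lev 5, lev 5#} \<noteq> K (lev 1)"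
      by (rule notI, drule arg_cong[of _ _ "\<lambda>M. count M 1"]) (simp add: lev_simps K_def)
  qed (auto simp: lev_simps K_def peel_def split: if_splits)
  show ?thesis by (rule long_refinement_G)
qed

text \<open>The pair \<open>2 * k + 5\<close> between the X letters is alone in the top layer
  \<open>k + 2\<close>. The X pairs share the level \<open>k + 1\<close> of the pair 1, so their
  edge to it replaces a loop.\<close>

lemma long_refinement_family2:
  assumes "\<Xi> \<in> family2"
  shows "long_refinement_graph (string_graph \<Xi>)"
proof -
  obtain k where \<Xi>: "\<Xi> = [LS] @ word_power [L1] k @ [L0, L0] @ word_power [L1] k @ [LX, L1, LX]
     @ word_power [L1] k @ [L0]"
    using assms by (auto simp: family2_def)
  have len: "length \<Xi> = 3 * k + 7" by (simp add: \<Xi>)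
  have letters: "letter_at \<Xi> i = (if i = 2 * k + 4 \<or> i = 2 * k + 6 then LX
      else if i = k + 2 \<or> i = k + 3 \<or> i = 3 * k + 7 then L0 else L1)" if "i \<in> {2..3 * k + 7}" for i
    using that unfolding letter_at_def \<Xi>
    by (auto simp: nth_append nth_Cons' nth_word_power_letters)
  interpret string_shape \<Xi> "3 * k + 7" "2 * k + 4" "2 * k + 6"
    using string_shapeI[of \<Xi> "2 * k + 4" "2 * k + 6"] assms unfolding len by (simp add: letters)
  define lev where "lev = (fold_lev (k + 2) (2 * k + 5) (3 * k + 7))(1 := k + 1)"
  define K :: "nat \<Rightarrow> nat multiset" where "K d = (if d = 0 then {#0, 1#}
    else if d = k + 2 then {#d - 1, d - 1, d#} else {#d - 1, d, d + 1#})" for d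
  have lev_simps: "lev 1 = k + 1" "lev (Suc 0) = k + 1" "lev 2 = k" "lev (2 * k + 4) = k + 1" "lev (2 * k + 6) = k + 1"
    by (auto simp: lev_def fold_lev_def)
  interpret layered_shape \<Xi> "3 * k + 7" "2 * k + 4" "2 * k + 6" lev K "\<lambda>d. d = 0" "\<lambda>_. False" 1 "k + 2" 0
  proof
    fix i assume i: "i \<in> {2..3 * k + 7}"
    consider "i = 2 * k + 5" | "i = 2 * k + 6" | "i = 2 * k + 4" |
      "i \<noteq> 2 * k + 4" "i \<noteq> 2 * k + 5" "i \<noteq> 2 * k + 6" by blast
    then show "image_mset lev (N i) = K (lev i)"
    proof cases
      case 1
      then show ?thesis
        using image_fold_lev_N_h(1)[OF lev_def] i
        by (simp add: letters K_def lev_def fold_lev_def add_mset_commute)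
    next
      case 2
      then show ?thesis
        using image_fold_lev_N_h(2)[OF lev_def] i
        by (simp add: letters K_def lev_simps add_mset_commute add.commute[of 6 "2 * k"])
    next
      case 3
      then show ?thesis
        using image_fold_lev_N[OF lev_def, of i] i
        by (simp add: letters K_def lev_simps add_mset_commute)
    next
      case 4
      then have "letter_at \<Xi> i = L1 \<longleftrightarrow> lev i \<noteq> 0" "lev i \<noteq> k + 2"
        using i by (auto simp: letters lev_def fold_lev_def)
      then show ?thesis
        using image_fold_lev_N[OF lev_def, of i] i 4
        by (simp add: letters K_def add_mset_commute)
    qed
  next
    show "image_mset (peel (\<lambda>_. False) (k + 2 - 1)) {#lev 2, lev (2 * k + 4), lev (2 * k + 4)#} =
        image_mset (peel (\<lambda>_. False) (k + 2 - 1)) (K (lev 1))"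
      by (simp add: lev_simps K_def peel_def)
    show "{#lev 2, lev (2 * k + 4), lev (2 * k + 4)#} \<noteq> K (lev 1)"
      by (simp add: lev_simps K_def)
  qed (auto simp: lev_simps K_def split: if_splits, auto simp: lev_def fold_lev_def split: if_splits)
  show ?thesis by (rule long_refinement_G)
qed

text \<open>The top layer \<open>k + 2\<close> consists of the pairs 1 and 2, so
  \<open>q = 2\<close> and the level of 1 is one less than the folded one. The X pairs have level
  \<open>k + 1\<close>; each serves as a loop for the other, with the pair 1 as upper
  neighbour.\<close>

lemma long_refinement_family3:
  assumes "\<Xi> \<in> family3"
  shows "long_refinement_graph (string_graph \<Xi>)"
proof -
  obtain k where \<Xi>: "\<Xi> = [LS] @ word_power [L1] k @ [L1, L1, L0, L0] @ word_power [L1] k @ [LX, LX]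
     @ word_power [L1] k @ [L0]"
    using assms by (auto simp: family3_def)
  have len: "length \<Xi> = 3 * k + 8" by (simp add: \<Xi>)
  have letters: "letter_at \<Xi> i = (if i = 2 * k + 6 \<or> i = 2 * k + 7 then LX
      else if i = k + 4 \<or> i = k + 5 \<or> i = 3 * k + 8 then L0 else L1)" if "i \<in> {2..3 * k + 8}" for i
    using that unfolding letter_at_def \<Xi>
    by (auto simp: nth_append nth_Cons' nth_word_power_letters)
  interpret string_shape \<Xi> "3 * k + 8" "2 * k + 6" "2 * k + 7"
    using string_shapeI[of \<Xi> "2 * k + 6" "2 * k + 7"] assms unfolding len by (simp add: letters)
  define lev where "lev = (fold_lev (k + 4) (2 * k + 6) (3 * k + 8))(1 := k + 2)"
  define K :: "nat \<Rightarrow> nat multiset" where "K d = (if d = 0 then {#0, 1#}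
    else if d = k + 2 then {#d - 1, d, d#} else {#d - 1, d, d + 1#})" for d
  have lev_simps: "lev 1 = k + 2" "lev (Suc 0) = k + 2" "lev 2 = k + 2" "lev (2 * k + 6) = k + 1" "lev (2 * k + 7) = k + 1"
    by (auto simp: lev_def fold_lev_def)
  interpret layered_shape \<Xi> "3 * k + 8" "2 * k + 6" "2 * k + 7" lev K "\<lambda>d. d = 0" "\<lambda>_. False" 2 "k + 2" 0
  proof
    fix i assume i: "i \<in> {2..3 * k + 8}"
    consider "i = 2 * k + 6" | "i = 2 * k + 7" | "i = 2" |
      "i \<noteq> 2" "i \<noteq> 2 * k + 6" "i \<noteq> 2 * k + 7" by blast
    then show "image_mset lev (N i) = K (lev i)"
    proof cases
      case 1
      then show ?thesis
        using image_fold_lev_N_h(1)[OF lev_def] i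
        by (simp add: letters K_def lev_def fold_lev_def add_mset_commute)
    next
      case 2
      then show ?thesis
        using image_fold_lev_N_h(2)[OF lev_def] i
        by (simp add: letters K_def lev_simps add_mset_commute add.commute[of 7 "2 * k"])
    next
      case 3
      have "lev 3 = k + 1" by (simp add: lev_def fold_lev_def)
      then show ?thesis
        using 3 i by (simp add: image_N loop_def letters K_def lev_simps add_mset_commute flip: One_nat_def)
    next
      case 4
      then have "letter_at \<Xi> i = L1 \<longleftrightarrow> lev i \<noteq> 0" "lev i \<noteq> k + 2"
        using i by (auto simp: letters lev_def fold_lev_def)
      then show ?thesis
        using image_fold_lev_N[OF lev_def, of i] i 4
        by (simp add: letters K_def add_mset_commute)
    qed
  next
    show "image_mset (peel (\<lambda>_. False) (k + 2 - 1)) {#lev 2, lev (2 * k + 6), lev (2 * k + 6)#} =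
        image_mset (peel (\<lambda>_. False) (k + 2 - 1)) (K (lev 1))"
      by (simp add: lev_simps K_def peel_def)
    show "{#lev 2, lev (2 * k + 6), lev (2 * k + 6)#} \<noteq> K (lev 1)"
      by (simp add: lev_simps K_def)
  qed (auto simp: lev_simps K_def split: if_splits, auto simp: lev_def fold_lev_def split: if_splits)
  show ?thesis by (rule long_refinement_G)
qed

text \<open>The X pairs form the top layer \<open>k + 2\<close>: each serves as a loop for the
  other, and the pair 1 on level \<open>k + 1\<close> is a second lower neighbour.\<close>

lemma long_refinement_family4:
  assumes "\<Xi> \<in> family4"
  shows "long_refinement_graph (string_graph \<Xi>)"
proof -
  obtain k where \<Xi>: "\<Xi> = [LS] @ word_power [L1] k @ [L0, L0, L1] @ word_power [L1] k @ [LX, LX]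
     @ word_power [L1] k @ [L1, L0]"
    using assms by (auto simp: family4_def)
  have len: "length \<Xi> = 3 * k + 8" by (simp add: \<Xi>)
  have letters: "letter_at \<Xi> i = (if i = 2 * k + 5 \<or> i = 2 * k + 6 then LX
      else if i = k + 2 \<or> i = k + 3 \<or> i = 3 * k + 8 then L0 else L1)" if "i \<in> {2..3 * k + 8}" for i
    using that unfolding letter_at_def \<Xi>
    by (auto simp: nth_append nth_Cons' nth_word_power_letters)
  interpret string_shape \<Xi> "3 * k + 8" "2 * k + 5" "2 * k + 6"
    using string_shapeI[of \<Xi> "2 * k + 5" "2 * k + 6"] assms unfolding len by (simp add: letters)
  define lev where "lev = (fold_lev (k + 2) (2 * k + 5) (3 * k + 8))(1 := k + 1)"
  define K :: "nat \<Rightarrow> nat multiset" where "K d = (if d = 0 then {#0, 1#}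
    else if d = k + 2 then {#d - 1, d - 1, d#} else {#d - 1, d, d + 1#})" for d
  have lev_simps: "lev 1 = k + 1" "lev (Suc 0) = k + 1" "lev 2 = k" "lev (2 * k + 5) = k + 2" "lev (2 * k + 6) = k + 2"
    by (auto simp: lev_def fold_lev_def)
  interpret layered_shape \<Xi> "3 * k + 8" "2 * k + 5" "2 * k + 6" lev K "\<lambda>d. d = 0" "\<lambda>_. False" 1 "k + 2" 0
  proof
    fix i assume i: "i \<in> {2..3 * k + 8}"
    consider "i = 2 * k + 5" | "i = 2 * k + 6" | "i \<noteq> 2 * k + 5" "i \<noteq> 2 * k + 6" by blast
    then show "image_mset lev (N i) = K (lev i)"
    proof cases
      case 1
      then show ?thesis
        using image_fold_lev_N_h(1)[OF lev_def] i
        by (simp add: letters K_def lev_def fold_lev_def add_mset_commute)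
    next
      case 2
      then show ?thesis
        using image_fold_lev_N_h(2)[OF lev_def] i
        by (simp add: letters K_def lev_simps add_mset_commute add.commute[of 6 "2 * k"])
    next
      case 3
      then have "letter_at \<Xi> i = L1 \<longleftrightarrow> lev i \<noteq> 0" "lev i \<noteq> k + 2"
        using i by (auto simp: letters lev_def fold_lev_def)
      then show ?thesis
        using image_fold_lev_N[OF lev_def, of i] i 3
        by (simp add: letters K_def add_mset_commute)
    qed
  next
    show "image_mset (peel (\<lambda>_. False) (k + 2 - 1)) {#lev 2, lev (2 * k + 5), lev (2 * k + 5)#} =
        image_mset (peel (\<lambda>_. False) (k + 2 - 1)) (K (lev 1))"
      by (simp add: lev_simps K_def peel_def)
    show "{#lev 2, lev (2 * k + 5), lev (2 * k + 5)#} \<noteq> K (lev 1)"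
      by (simp add: lev_simps K_def)
  qed (auto simp: lev_simps K_def split: if_splits, auto simp: lev_def fold_lev_def split: if_splits)
  show ?thesis by (rule long_refinement_G)
qed

section \<open>The families of period three\<close>

lemma dvd_3_diff: "(n :: nat) < k * 3 \<Longrightarrow> 3 dvd 3 * k - n \<longleftrightarrow> n mod 3 = 0"
  by presburger

lemma dvd_3_Suc: "3 dvd Suc n \<longleftrightarrow> n mod 3 = 2"
  by presburger

lemma dvd_3_cases:
  "3 dvd Suc d \<and> \<not> 3 dvd d \<and> \<not> 3 dvd Suc (Suc d) \<or>
   \<not> 3 dvd Suc d \<and> 3 dvd d \<and> \<not> 3 dvd Suc (Suc d) \<or>
   \<not> 3 dvd Suc d \<and> \<not> 3 dvd d \<and> 3 dvd Suc (Suc d)"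
  by presburger

lemma dvd_3_numeral [simp]:
  "\<not> 3 dvd Suc (3 * k)" "\<not> 3 dvd Suc (Suc (3 * k))" "3 dvd Suc (Suc (Suc (3 * k)))"
  by presburger+

text \<open>Degree 2 occurs exactly on the levels divisible by 3. The pair 2 alone forms the top
  layer \<open>3 * k + 3\<close>, and the strip is reflected there: 1 and 3 share the level
  \<open>3 * k + 2\<close>, so \<open>q = 3\<close>.\<close>

lemma long_refinement_family5:
  assumes "\<Xi> \<in> family5"
  shows "long_refinement_graph (string_graph \<Xi>)"
proof -
  obtain k where \<Xi>: "\<Xi> = [LS, L0, L1, L1] @ word_power [L0, L1, L1] k @ [L0, L0]
     @ word_power [L1, L1, L0] k @ [LX, LX] @ word_power [L0, L1, L1] k @ [L0]"
    using assms by (auto simp: family5_def)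
  have len: "length \<Xi> = 9 * k + 9" by (simp add: \<Xi>)
  have letters: "letter_at \<Xi> i = (if i = 6 * k + 7 \<or> i = 6 * k + 8 then LX
      else if 3 dvd fold_lev (3 * k + 5) (6 * k + 7) (9 * k + 9) i then L0 else L1)" if "i \<in> {2..9 * k + 9}" for i
  proof -
    \<comment> \<open>The three ranges are the three repeated words; the remaining positions are
      checked one by one.\<close>
    have "5 \<le> i \<and> i < 3 * k + 5 \<or>
        3 * k + 7 \<le> i \<and> i < 6 * k + 7 \<or>
        6 * k + 9 \<le> i \<and> i < 9 * k + 9 \<or>
        i = 2 \<or> i = 3 \<or> i = 4 \<or> i = 3 * k + 5 \<or> i = 3 * k + 6 \<or> i = 6 * k + 7 \<or> i = 6 * k + 8 \<or> i = 9 * k + 9"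
      using that unfolding atLeastAtMost_iff by linarith
    then consider "5 \<le> i" "i < 3 * k + 5" | "3 * k + 7 \<le> i" "i < 6 * k + 7" | "6 * k + 9 \<le> i" "i < 9 * k + 9" |
        "i \<in> {2, 3, 4, 3 * k + 5, 3 * k + 6, 6 * k + 7, 6 * k + 8, 9 * k + 9}"
      by blast
    then show ?thesis
    proof cases
      case 1
      define n where "n = i - 5"
      have "i = n + 5" "n < k * 3" using 1 by (auto simp: n_def)
      then show ?thesis
        by (simp add: letter_at_def \<Xi> nth_append nth_word_power_letters fold_lev_def dvd_3_diff dvd_3_Suc)
    next
      case 2
      define n where "n = i - (3 * k + 7)"
      have "i = n + (3 * k + 7)" "n < k * 3" using 2 by (auto simp: n_def)
      then show ?thesis
        by (simp add: letter_at_def \<Xi> nth_append nth_word_power_letters fold_lev_def dvd_3_diff dvd_3_Suc)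
    next
      case 3
      define n where "n = i - (6 * k + 9)"
      have "i = n + (6 * k + 9)" "n < k * 3" using 3 by (auto simp: n_def)
      then show ?thesis
        by (simp add: letter_at_def \<Xi> nth_append nth_word_power_letters fold_lev_def dvd_3_diff dvd_3_Suc)
    next
      case 4
      then show ?thesis
        by (elim insertE emptyE) (simp_all add: letter_at_def \<Xi> nth_append fold_lev_def)
    qed
  qed
  interpret string_shape \<Xi> "9 * k + 9" "6 * k + 7" "6 * k + 8"
    using string_shapeI[of \<Xi> "6 * k + 7" "6 * k + 8"] assms
      letters[of "6 * k + 7"] letters[of "6 * k + 8"] by (simp add: len)
  define lev where "lev = (fold_lev (3 * k + 5) (6 * k + 7) (9 * k + 9))(1 := 3 * k + 2)"
  define K :: "nat \<Rightarrow> nat multiset" where "K d = (if d = 0 then {#0, 1#}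
    else if d = 3 * k + 3 then {#d - 1, d - 1#}
    else if 3 dvd d then {#d - 1, d + 1#} else {#d - 1, d, d + 1#})" for d
  have lev_simps: "lev 1 = 3 * k + 2" "lev (Suc 0) = 3 * k + 2" "lev 2 = 3 * k + 3" "lev (6 * k + 7) = 3 * k + 1" "lev (6 * k + 8) = 3 * k + 1"
    by (auto simp: lev_def fold_lev_def)
  \<comment> \<open>Among three consecutive levels exactly one is divisible by 3, so a layer of
    degree 3 sees exactly one neighbour level of degree 2, and a layer of degree 2 above the bottom
    sees none. This gives both \<open>K_coarse\<close> and \<open>K_bottom\<close>.\<close>
  have K_image: "image_mset (\<lambda>d. 3 dvd d) (K (Suc d)) =
      (if 3 dvd Suc d then {#False, False#} else {#True, False, False#})" if "d \<le> 3 * k + 2" for d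
  proof -
    consider "3 dvd Suc d" "\<not> 3 dvd d" "\<not> 3 dvd Suc (Suc d)" |
      "\<not> 3 dvd Suc d" "3 dvd d" "\<not> 3 dvd Suc (Suc d)" |
      "\<not> 3 dvd Suc d" "\<not> 3 dvd d" "3 dvd Suc (Suc d)"
      using dvd_3_cases by blast
    moreover have "d = Suc (Suc (3 * k)) \<longrightarrow> 3 dvd Suc d" "d = Suc (3 * k) \<longrightarrow> 3 dvd Suc (Suc d)"
      by presburger+
    ultimately show ?thesis
      using that by cases (auto simp: K_def add_mset_commute)
  qed
  interpret layered_shape \<Xi> "9 * k + 9" "6 * k + 7" "6 * k + 8" lev K "\<lambda>d. 3 dvd d" "\<lambda>d. 3 dvd d" 3 "3 * k + 2" 1
  proof
    fix i assume i: "i \<in> {2..9 * k + 9}"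
    consider "i = 6 * k + 7" | "i = 6 * k + 8" | "i = 2" |
      "i \<noteq> 2" "i \<noteq> 6 * k + 7" "i \<noteq> 6 * k + 8" by blast
    then show "image_mset lev (N i) = K (lev i)"
    proof cases
      case 1
      then show ?thesis
        using image_fold_lev_N_h(1)[OF lev_def] i
        by (simp add: letters K_def lev_def fold_lev_def add_mset_commute)
    next
      case 2
      then show ?thesis
        using image_fold_lev_N_h(2)[OF lev_def] i
        by (simp add: letters K_def lev_simps fold_lev_def add_mset_commute add.commute[of 8 "6 * k"])
    next
      case 3
      have "lev 3 = 3 * k + 2" "3 dvd 3 * k + 3" by (simp_all add: lev_def fold_lev_def)
      then show ?thesis
        using 3 i by (simp add: image_N loop_def letters K_def lev_simps fold_lev_def)
    next
      case 4
      have "lev i = fold_lev (3 * k + 5) (6 * k + 7) (9 * k + 9) i"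
        using i by (simp add: lev_def)
      then have "letter_at \<Xi> i = L1 \<longleftrightarrow> \<not> 3 dvd lev i" "lev i \<noteq> 3 * k + 3"
        using i 4 by (auto simp: letters fold_lev_def)
      then show ?thesis
        using image_fold_lev_N[OF lev_def, of i] i 4
        by (simp add: letters K_def fold_lev_def add_mset_commute)
    qed
  next
    show "image_mset (peel (\<lambda>d. 3 dvd d) (3 * k + 2 - 1)) {#lev 2, lev (6 * k + 7), lev (6 * k + 7)#} =
        image_mset (peel (\<lambda>d. 3 dvd d) (3 * k + 2 - 1)) (K (lev 1))"
      by (simp add: lev_simps K_def peel_def)
    show "{#lev 2, lev (6 * k + 7), lev (6 * k + 7)#} \<noteq> K (lev 1)"
      by (rule notI, drule arg_cong[of _ _ "\<lambda>M. count M (3 * k + 2)"]) (simp add: lev_simps K_def)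
    show "image_mset (\<lambda>d. 3 dvd d) (K (Suc d)) = image_mset (\<lambda>d. 3 dvd d) (K (Suc e))"
      if "d \<le> 3 * k + 2" "e \<le> 3 * k + 2" "(3 dvd Suc d) = (3 dvd Suc e)" for d e
      using that by (simp only: K_image)
    show "(3 dvd d \<and> (\<exists>x \<in># K d. 3 dvd x)) \<longleftrightarrow> d = 0" if "d \<le> Suc (3 * k + 2)" for d
    proof (cases d)
      case (Suc e)
      have "(\<exists>x \<in># K d. 3 dvd x) \<longleftrightarrow> True \<in># image_mset (\<lambda>d. 3 dvd d) (K d)"
        by auto
      then show ?thesis using that unfolding Suc by (subst (asm) K_image) auto
    qed (simp add: K_def)
  qed (auto simp: lev_simps K_def split: if_splits, auto simp: lev_def fold_lev_def split: if_splits)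
  show ?thesis by (rule long_refinement_G)
qed

text \<open>Degree 2 again marks the levels divisible by 3. The top layer \<open>3 * k + 3\<close>
  is the pair between the X letters; below it the X pairs form the layer \<open>3 * k + 2\<close>,
  with the pair 1 as second lower neighbour in place of a loop.\<close>

lemma long_refinement_family6:
  assumes "\<Xi> \<in> family6"
  shows "long_refinement_graph (string_graph \<Xi>)"
proof -
  obtain k where \<Xi>: "\<Xi> = [LS] @ word_power [L0, L1, L1] k @ [L0, L0] @ word_power [L1, L1, L0] k
     @ [L1, LX, L0, LX, L1] @ word_power [L0, L1, L1] k @ [L0]"
    using assms by (auto simp: family6_def)
  have len: "length \<Xi> = 9 * k + 9" by (simp add: \<Xi>)
  have letters: "letter_at \<Xi> i = (if i = 6 * k + 5 \<or> i = 6 * k + 7 then LX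
      else if 3 dvd fold_lev (3 * k + 2) (6 * k + 6) (9 * k + 9) i then L0 else L1)" if "i \<in> {2..9 * k + 9}" for i
  proof -
    have "2 \<le> i \<and> i < 3 * k + 2 \<or>
        3 * k + 4 \<le> i \<and> i < 6 * k + 4 \<or>
        6 * k + 9 \<le> i \<and> i < 9 * k + 9 \<or>
        i = 3 * k + 2 \<or> i = 3 * k + 3 \<or> i = 6 * k + 4 \<or> i = 6 * k + 5 \<or> i = 6 * k + 6 \<or> i = 6 * k + 7 \<or> i = 6 * k + 8 \<or> i = 9 * k + 9"
      using that unfolding atLeastAtMost_iff by linarith
    then consider "2 \<le> i" "i < 3 * k + 2" | "3 * k + 4 \<le> i" "i < 6 * k + 4" | "6 * k + 9 \<le> i" "i < 9 * k + 9" |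
        "i \<in> {3 * k + 2, 3 * k + 3, 6 * k + 4, 6 * k + 5, 6 * k + 6, 6 * k + 7, 6 * k + 8, 9 * k + 9}"
      by blast
    then show ?thesis
    proof cases
      case 1
      define n where "n = i - 2"
      have "i = n + 2" "n < k * 3" using 1 by (auto simp: n_def)
      then show ?thesis
        by (simp add: letter_at_def \<Xi> nth_append nth_word_power_letters fold_lev_def dvd_3_diff dvd_3_Suc)
    next
      case 2
      define n where "n = i - (3 * k + 4)"
      have "i = n + (3 * k + 4)" "n < k * 3" using 2 by (auto simp: n_def)
      then show ?thesis
        by (simp add: letter_at_def \<Xi> nth_append nth_word_power_letters fold_lev_def dvd_3_diff dvd_3_Suc)
    next
      case 3
      define n where "n = i - (6 * k + 9)"
      have "i = n + (6 * k + 9)" "n < k * 3" using 3 by (auto simp: n_def)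
      then show ?thesis
        by (simp add: letter_at_def \<Xi> nth_append nth_word_power_letters fold_lev_def dvd_3_diff dvd_3_Suc)
    next
      case 4
      then show ?thesis
        by (elim insertE emptyE) (simp_all add: letter_at_def \<Xi> nth_append fold_lev_def)
    qed
  qed
  interpret string_shape \<Xi> "9 * k + 9" "6 * k + 5" "6 * k + 7"
    using string_shapeI[of \<Xi> "6 * k + 5" "6 * k + 7"] assms
      letters[of "6 * k + 5"] letters[of "6 * k + 7"] by (simp add: len)
  define lev where "lev = (fold_lev (3 * k + 2) (6 * k + 6) (9 * k + 9))(1 := 3 * k + 1)"
  define K :: "nat \<Rightarrow> nat multiset" where "K d = (if d = 0 then {#0, 1#}
    else if d = 3 * k + 3 then {#d - 1, d - 1#}
    else if d = 3 * k + 2 then {#d - 1, d - 1, d + 1#}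
    else if 3 dvd d then {#d - 1, d + 1#} else {#d - 1, d, d + 1#})" for d
  have lev_simps: "lev 1 = 3 * k + 1" "lev (Suc 0) = 3 * k + 1" "lev 2 = 3 * k" "lev (6 * k + 5) = 3 * k + 2" "lev (6 * k + 7) = 3 * k + 2"
    by (auto simp: lev_def fold_lev_def)
  have K_image: "image_mset (\<lambda>d. 3 dvd d) (K (Suc d)) =
      (if 3 dvd Suc d then {#False, False#} else {#True, False, False#})" if "d \<le> 3 * k + 2" for d
  proof -
    consider "3 dvd Suc d" "\<not> 3 dvd d" "\<not> 3 dvd Suc (Suc d)" |
      "\<not> 3 dvd Suc d" "3 dvd d" "\<not> 3 dvd Suc (Suc d)" |
      "\<not> 3 dvd Suc d" "\<not> 3 dvd d" "3 dvd Suc (Suc d)"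
      using dvd_3_cases by blast
    \<comment> \<open>These place the two topmost levels, where \<open>K\<close> departs from the
      periodic pattern, in the right cases.\<close>
    moreover have "d = Suc (Suc (3 * k)) \<longrightarrow> 3 dvd Suc d" "d = Suc (3 * k) \<longrightarrow> 3 dvd Suc (Suc d)"
      by presburger+
    ultimately show ?thesis
      using that by cases (auto simp: K_def add_mset_commute)
  qed
  interpret layered_shape \<Xi> "9 * k + 9" "6 * k + 5" "6 * k + 7" lev K "\<lambda>d. 3 dvd d" "\<lambda>d. 3 dvd d" 1 "3 * k + 2" 1
  proof
    fix i assume i: "i \<in> {2..9 * k + 9}"
    consider "i = 6 * k + 6" | "i = 6 * k + 7" | "i = 6 * k + 5" |
      "i \<noteq> 6 * k + 5" "i \<noteq> 6 * k + 6" "i \<noteq> 6 * k + 7" by blast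
    then show "image_mset lev (N i) = K (lev i)"
    proof cases
      case 1
      then show ?thesis
        using image_fold_lev_N_h(1)[OF lev_def] i
        by (simp add: letters K_def lev_def fold_lev_def add_mset_commute)
    next
      case 2
      then show ?thesis
        using image_fold_lev_N_h(2)[OF lev_def] i
        by (simp add: letters K_def lev_simps fold_lev_def add_mset_commute add.commute[of 7 "6 * k"])
    next
      case 3
      then show ?thesis
        using image_fold_lev_N[OF lev_def, of i] i
        by (simp add: letters K_def lev_simps fold_lev_def add_mset_commute)
    next
      case 4
      have "lev i = fold_lev (3 * k + 2) (6 * k + 6) (9 * k + 9) i"
        using i by (simp add: lev_def)
      then have "letter_at \<Xi> i = L1 \<longleftrightarrow> \<not> 3 dvd lev i" "lev i \<noteq> 3 * k + 3" "lev i \<noteq> 3 * k + 2"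
        using i 4 by (auto simp: letters fold_lev_def)
      then show ?thesis
        using image_fold_lev_N[OF lev_def, of i] i 4
        by (simp add: letters K_def fold_lev_def add_mset_commute)
    qed
  next
    show "image_mset (peel (\<lambda>d. 3 dvd d) (3 * k + 2 - 1)) {#lev 2, lev (6 * k + 5), lev (6 * k + 5)#} =
        image_mset (peel (\<lambda>d. 3 dvd d) (3 * k + 2 - 1)) (K (lev 1))"
      by (simp add: lev_simps K_def peel_def)
    show "{#lev 2, lev (6 * k + 5), lev (6 * k + 5)#} \<noteq> K (lev 1)"
      by (simp add: lev_simps K_def)
    show "image_mset (\<lambda>d. 3 dvd d) (K (Suc d)) = image_mset (\<lambda>d. 3 dvd d) (K (Suc e))"
      if "d \<le> 3 * k + 2" "e \<le> 3 * k + 2" "(3 dvd Suc d) = (3 dvd Suc e)" for d e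
      using that by (simp only: K_image)
    show "(3 dvd d \<and> (\<exists>x \<in># K d. 3 dvd x)) \<longleftrightarrow> d = 0" if "d \<le> Suc (3 * k + 2)" for d
    proof (cases d)
      case (Suc e)
      have "(\<exists>x \<in># K d. 3 dvd x) \<longleftrightarrow> True \<in># image_mset (\<lambda>d. 3 dvd d) (K d)"
        by auto
      then show ?thesis using that unfolding Suc by (subst (asm) K_image) auto
    qed (simp add: K_def)
  qed (auto simp: lev_simps K_def split: if_splits, auto simp: lev_def fold_lev_def split: if_splits)
  show ?thesis by (rule long_refinement_G)
qed

theorem theorem19:
  fixes \<Xi> :: "letter list"
  assumes "\<Xi> \<in> family1 \<union> family2 \<union> family3 \<union> family4 \<union> family5 \<union> family6"
  shows "long_refinement_graph (string_graph \<Xi>)"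
  using assms long_refinement_family1 long_refinement_family2 long_refinement_family3
    long_refinement_family4 long_refinement_family5 long_refinement_family6 by blast

end
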